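(* Let $\lambda\in\mathbf{k}$ be arbitrary. Let $A$ be an algebra with a presentation $A=\mathbf{k}\langle X\rangle/I_A$, where $X$ is a well-ordered generating set and $I_A$ is an ideal of $\mathbf{k}\langle X\rangle$. Let $S$ be a Gröbner-Shirshov basis of $I_A$ with respect to the deg-lex order on $M(X)$, and let $\hat S:=\hat i_X(S)\subseteq \mathbf{k}\langle\Delta(X)\rangle$. Let $\mathcal{D}_\lambda(A)$ be the free differential algebra of weight $\lambda$ on $A$, with presentation $\mathcal{D}_\lambda(A)=\mathbf{k}\langle\Delta(X)\rangle/\mathrm{DI}(\hat S)$, where $\mathrm{DI}(\hat S)$ is the differential ideal of $\mathbf{k}\langle\Delta(X)\rangle$ generated by $\hat S$. Then $\hat S$ is a (differential) Gröbner-Shirshov basis of $\mathrm{DI}(\hat S)$. Furthermore, if $S$ is minimal (resp. reduced), then $\hat S$ is also minimal (resp. reduced).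
   Context: $\mathbf{k}$ is a field of characteristic $0$; algebras are associative unital $\mathbf{k}$-algebras. **Differential algebras.** For $\lambda\in\mathbf{k}$, a differential algebra of weight $\lambda$ is an algebra $R$ with a linear map $d:R\to R$ such that $d(xy)=d(x)y+x\,d(y)+\lambda d(x)d(y)$ for all $x,y\in R$ and $d(1)=0$; homomorphisms are algebra homomorphisms commuting with the operators. A differential ideal is an ideal $I$ with $d(I)\subseteq I$; $\mathrm{DI}(U)$ is the smallest differential ideal containing $U$. The free differential algebra of weight $\lambda$ on an algebra $A$ is a differential algebra $(\mathcal{D}_\lambda(A),d_A)$ of weight $\lambda$ with an algebra homomorphism $i_A:A\to \mathcal{D}_\lambda(A)$ such that every algebra homomorphism $\varphi:A\to R$ to a differential algebra $(R,d)$ of weight $\lambda$ factors as $\varphi=\bar\varphi\circ i_A$ for a unique differential algebra homomorphism $\bar\varphi$. **The algebra $\mathbf{k}\langle\Delta(X)\rangle$.** $\Delta(X)=\{x^{(n)}\mid x\in X,\ n\ge0\}$ (distinct symbols). $\mathbf{k}\langle\Delta(X)\rangle$ is the noncommutative polynomial algebra, with the unique weight-$\lambda$ differential operator $d_X$ such that $d_X(x^{(n)})=x^{(n+1)}$. $M(Y)$ is the free monoid on $Y$ (words, including $1$). $\hat i_X:\mathbf{k}\langle X\rangle\to\mathbf{k}\langle\Delta(X)\rangle$ is the algebra embedding $x\mapsto x^{(0)}$. **Orders.** The well-order $<$ on $X$ is extended to $\Delta(X)$ by: $x^{(m)}\prec y^{(n)}$ iff $m<n$, or $m=n$ and $x<y$.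 On $M(X)$ and $M(\Delta(X))$ use the deg-lex orders: first compare the number of letters $|u|$ (fewer letters is smaller), then compare lexicographically from the left. $\overline f$ denotes the leading monomial of $f\ne0$, $\mathrm{lc}(f)$ its leading coefficient, $f^\natural=\mathrm{lc}(f)^{-1}f$; $\overline h$ and $h^\natural$ are only formed for $h\neq 0$. **Gröbner-Shirshov bases in $\mathbf{k}\langle X\rangle$.** A set $S$ of monic polynomials is a Gröbner-Shirshov basis if for all $f,g\in S$: (intersection compositions) whenever $w=\overline f u=v\overline g$ with $u,v\in M(X)$ and $|w|<|\overline f|+|\overline g|$, the element $fu-vg$ is trivial modulo $(S,w)$; (inclusion compositions) whenever $w=\overline f=u\overline g v$ with $u,v\in M(X)$, the element $f-ugv$ is trivial modulo $(S,w)$. Here an element is trivial modulo $(S,w)$ if it equals a finite sum $\sum_r c_r a_r s_r b_r$ with $c_r\in\mathbf{k}$, $s_r\in S$, $a_r,b_r\in M(X)$ and $a_r\overline{s_r}b_r<w$ for all $r$. It is a Gröbner-Shirshov basis of an ideal $I$ if moreover it generates $I$. It is minimal if it has no inclusion compositions (other than the vacuous ones of an element with itself, $f=g$, $u=v=1$), and reduced if every $f\in S$ is a linear combination of words not of the form $u\overline g v$ with $g\in S\setminus\{f\}$, $u,v\in M(X)$. **Differential Gröbner-Shirshov bases in $\mathbf{k}\langle\Delta(X)\rangle$.** Let $S$ be a set of monic polynomials in $\mathbf{k}\langle\Delta(X)\rangle$ and $w\in M(\Delta(X))$. An element is trivial modulo $(S,w)$ if it equals a finite sum $\sum_r c_r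 a_r d_X^{k_r}(s_r)b_r$ with $c_r\in\mathbf{k}$, $k_r\ge0$, $s_r\in S$, $a_r,b_r\in M(\Delta(X))$ and $a_r\overline{d_X^{k_r}(s_r)}b_r\prec w$ for all $r$. For $f,g\in S$ and $i,j\ge0$: if $w=\overline{d_X^i(f)}u=v\overline{d_X^j(g)}$ with $u,v\in M(\Delta(X))$ and $|w|<|\overline f|+|\overline g|$, then $d_X^i(f)^\natural u-v\,d_X^j(g)^\natural$ is an intersection composition with respect to $w$; if $w=\overline{d_X^i(f)}=a\overline{d_X^j(g)}b$ with $a,b\in M(\Delta(X))$, then $d_X^i(f)^\natural-a\,d_X^j(g)^\natural b$ is an inclusion composition with respect to $w$. $S$ is a (differential) Gröbner-Shirshov basis if all compositions of elements of $S$ are trivial modulo $(S,w)$ for the corresponding $w$; it is a Gröbner-Shirshov basis of $\mathrm{DI}(S)$. It is minimal if it has no inclusion compositions (other than the vacuous ones with $f=g$, $i=j$, $a=b=1$), and reduced if every $f\in S$ is a linear combination of words not of the form $a\,\overline{d_X^j(g)}\,b$ with $a,b\in M(\Delta(X))$, $j\ge0$, $g\in S\setminus\{d_X^i(f)\mid i\ge0\}$. *)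

theory Defs
  imports
    Complex_Main
    "HOL-Library.Poly_Mapping"
    "HOL-Library.List_Lenlexorder"
    "HOL-Library.Product_Lexorder"
begin

section \<open>Associative unital algebras and differential algebras\<close>

text \<open>The sort \<open>{ring, monoid_mult}\<close> is used instead of \<open>ring_1\<close> because the latter
  excludes the zero algebra.\<close>

locale assoc_algebra = vector_space scale
  for scale :: "'k::field \<Rightarrow> 'a::{ring,monoid_mult} \<Rightarrow> 'a" +
  assumes scale_mult_left: "scale c (x * y) = scale c x * y"
    and scale_mult_right: "scale c (x * y) = x * scale c y"

locale differential_algebra = assoc_algebra scale
  for scale :: "'k::field \<Rightarrow> 'a::{ring,monoid_mult} \<Rightarrow> 'a" +
  fixes lam :: 'k and d :: "'a \<Rightarrow> 'a"
  assumes d_add: "d (x + y) = d x + d y"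
    and d_scale: "d (scale c x) = scale c (d x)"
    and d_mult: "d (x * y) = d x * y + x * d y + scale lam (d x * d y)"
    and d_one: "d 1 = 0"

text \<open>Homomorphisms may be defined on a subalgebra \<open>R\<close> of the ambient type only; all their
  values outside \<open>R\<close> are irrelevant.\<close>

definition alg_hom_on ::
  "'a::{ring,monoid_mult} set \<Rightarrow> ('k::field \<Rightarrow> 'a \<Rightarrow> 'a) \<Rightarrow> ('k \<Rightarrow> 'b::{ring,monoid_mult} \<Rightarrow> 'b)
     \<Rightarrow> ('a \<Rightarrow> 'b) \<Rightarrow> bool" where
  "alg_hom_on R scaleA scaleB h \<longleftrightarrow>
     (\<forall>x\<in>R. \<forall>y\<in>R. h (x + y) = h x + h y) \<and>
     (\<forall>c. \<forall>x\<in>R. h (scaleA c x) = scaleB c (h x)) \<and>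
     (\<forall>x\<in>R. \<forall>y\<in>R. h (x * y) = h x * h y) \<and>
     h 1 = 1"

definition diff_hom_on ::
  "'a::{ring,monoid_mult} set \<Rightarrow> ('k::field \<Rightarrow> 'a \<Rightarrow> 'a) \<Rightarrow> ('a \<Rightarrow> 'a)
     \<Rightarrow> ('k \<Rightarrow> 'b::{ring,monoid_mult} \<Rightarrow> 'b) \<Rightarrow> ('b \<Rightarrow> 'b) \<Rightarrow> ('a \<Rightarrow> 'b) \<Rightarrow> bool" where
  "diff_hom_on R scaleA dA scaleB dB h \<longleftrightarrow>
     alg_hom_on R scaleA scaleB h \<and> (\<forall>x\<in>R. h (dA x) = dB (h x))"

text \<open>HOL cannot quantify over types inside a definition, so the universal property is stated for
  test algebras \<open>R\<close> on a type \<open>'r\<close>. A theorem that assumes this for an arbitrary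
  \<open>'r\<close> assumes less than the full universal property.\<close>

definition free_differential_algebra ::
  "'r::{ring,monoid_mult} itself \<Rightarrow> 'k::field \<Rightarrow> ('k \<Rightarrow> 'a::{ring,monoid_mult} \<Rightarrow> 'a)
     \<Rightarrow> ('k \<Rightarrow> 'd::{ring,monoid_mult} \<Rightarrow> 'd) \<Rightarrow> ('d \<Rightarrow> 'd) \<Rightarrow> ('a \<Rightarrow> 'd) \<Rightarrow> bool" where
  "free_differential_algebra T lam scaleA scaleD dD iA \<longleftrightarrow>
     differential_algebra scaleD lam dD \<and>
     alg_hom_on UNIV scaleA scaleD iA \<and>
     (\<forall>(scaleR :: 'k \<Rightarrow> 'r \<Rightarrow> 'r) dR \<phi>.
        differential_algebra scaleR lam dR \<longrightarrow> alg_hom_on UNIV scaleA scaleR \<phi> \<longrightarrow>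
        (\<exists>!\<psi>. diff_hom_on UNIV scaleD dD scaleR dR \<psi> \<and> \<psi> \<circ> iA = \<phi>))"

text \<open>Two-sided ideals of a subalgebra \<open>R\<close>.\<close>

definition ideal_in :: "'a::{ring,monoid_mult} set \<Rightarrow> 'a set \<Rightarrow> bool" where
  "ideal_in R I \<longleftrightarrow>
     I \<subseteq> R \<and> 0 \<in> I \<and> (\<forall>x\<in>I. \<forall>y\<in>I. x + y \<in> I) \<and>
     (\<forall>r\<in>R. \<forall>x\<in>I. r * x \<in> I \<and> x * r \<in> I)"

definition ideal_gen :: "'a::{ring,monoid_mult} set \<Rightarrow> 'a set \<Rightarrow> 'a set" where
  "ideal_gen R U = \<Inter>{I. ideal_in R I \<and> U \<subseteq> I}"

definition diff_ideal_gen ::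
  "'a::{ring,monoid_mult} set \<Rightarrow> ('a \<Rightarrow> 'a) \<Rightarrow> 'a set \<Rightarrow> 'a set" where
  "diff_ideal_gen R d U = \<Inter>{I. ideal_in R I \<and> d ` I \<subseteq> I \<and> U \<subseteq> I}"


section \<open>Noncommutative polynomials\<close>

text \<open>Lists form the free monoid under concatenation, so that \<open>'y list \<Rightarrow>\<^sub>0 'k\<close>, with the
  convolution product of \<^theory>\<open>HOL-Library.Poly_Mapping\<close>, is the noncommutative polynomial
  algebra on the letters \<open>'y\<close>.\<close>

instantiation list :: (type) monoid_add
begin

definition zero_list :: "'a list" where "zero_list = []"
definition plus_list :: "'a list \<Rightarrow> 'a list \<Rightarrow> 'a list" where "plus_list = (@)"

instance
  by standard (simp_all add: zero_list_def plus_list_def)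

end

type_synonym ('y, 'k) ncpoly = "'y list \<Rightarrow>\<^sub>0 'k"

abbreviation "keys \<equiv> Poly_Mapping.keys"
abbreviation "lookup \<equiv> Poly_Mapping.lookup"

text \<open>The set of letters is a subset \<open>Y\<close> of a type, rather than the whole type, so that it may be
  empty.\<close>

definition free_algebra :: "'y set \<Rightarrow> ('y, 'k::field) ncpoly set" where
  "free_algebra Y = {p. keys p \<subseteq> lists Y}"

definition mon :: "'y list \<Rightarrow> ('y, 'k::field) ncpoly" where
  "mon u = Poly_Mapping.single u 1"

definition smul :: "'k::field \<Rightarrow> ('y, 'k) ncpoly \<Rightarrow> ('y, 'k) ncpoly" where
  "smul c p = Poly_Mapping.map ((*) c) p"

definition lin_ext :: "('y list \<Rightarrow> ('z, 'k) ncpoly) \<Rightarrow> ('y, 'k::field) ncpoly \<Rightarrow> ('z, 'k) ncpoly" where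
  "lin_ext F p = (\<Sum>u\<in>keys p. smul (lookup p u) (F u))"

text \<open>The order on \<open>'y list\<close> is the length-first lexicographic one of
  \<^theory>\<open>HOL-Library.List_Lenlexorder\<close>, i.e. deg-lex. The following are meaningful for nonzero
  polynomials only.\<close>

definition lm :: "('y::linorder, 'k::field) ncpoly \<Rightarrow> 'y list" where
  "lm p = Max (keys p)"

definition lc :: "('y::linorder, 'k::field) ncpoly \<Rightarrow> 'k" where
  "lc p = lookup p (lm p)"

definition nrm :: "('y::linorder, 'k::field) ncpoly \<Rightarrow> ('y, 'k) ncpoly" where
  "nrm p = smul (inverse (lc p)) p"

definition monic :: "('y::linorder, 'k::field) ncpoly \<Rightarrow> bool" where
  "monic p \<longleftrightarrow> p \<noteq> 0 \<and> lc p = 1"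


section \<open>Groebner-Shirshov bases in the free algebra\<close>

definition trivial_mod ::
  "'y::linorder set \<Rightarrow> ('y, 'k::field) ncpoly set \<Rightarrow> 'y list \<Rightarrow> ('y, 'k) ncpoly \<Rightarrow> bool" where
  "trivial_mod Y S w h \<longleftrightarrow>
     (\<exists>ts :: ('k \<times> 'y list \<times> ('y, 'k) ncpoly \<times> 'y list) list.
        (\<forall>(c, a, s, b) \<in> set ts.
           s \<in> S \<and> a \<in> lists Y \<and> b \<in> lists Y \<and> a @ lm s @ b < w) \<and>
        h = (\<Sum>(c, a, s, b)\<leftarrow>ts. smul c (mon a * s * mon b)))"

definition GS_basis :: "'y::linorder set \<Rightarrow> ('y, 'k::field) ncpoly set \<Rightarrow> bool" where
  "GS_basis Y S \<longleftrightarrow>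
     S \<subseteq> free_algebra Y \<and> (\<forall>s\<in>S. monic s) \<and>
     (\<forall>f\<in>S. \<forall>g\<in>S. \<forall>u\<in>lists Y. \<forall>v\<in>lists Y. \<forall>w.
        (w = lm f @ u \<and> w = v @ lm g \<and> length w < length (lm f) + length (lm g)
           \<longrightarrow> trivial_mod Y S w (f * mon u - mon v * g)) \<and>
        (w = lm f \<and> w = u @ lm g @ v
           \<longrightarrow> trivial_mod Y S w (f - mon u * g * mon v)))"

definition GS_basis_of ::
  "'y::linorder set \<Rightarrow> ('y, 'k::field) ncpoly set \<Rightarrow> ('y, 'k) ncpoly set \<Rightarrow> bool" where
  "GS_basis_of Y S I \<longleftrightarrow> GS_basis Y S \<and> ideal_gen (free_algebra Y) S = I"

definition GS_minimal :: "'y::linorder set \<Rightarrow> ('y, 'k::field) ncpoly set \<Rightarrow> bool" where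
  "GS_minimal Y S \<longleftrightarrow>
     (\<forall>f\<in>S. \<forall>g\<in>S. \<forall>u\<in>lists Y. \<forall>v\<in>lists Y.
        lm f = u @ lm g @ v \<longrightarrow> f = g \<and> u = [] \<and> v = [])"

definition GS_reduced :: "'y::linorder set \<Rightarrow> ('y, 'k::field) ncpoly set \<Rightarrow> bool" where
  "GS_reduced Y S \<longleftrightarrow>
     (\<forall>f\<in>S. \<forall>t\<in>keys f. \<not> (\<exists>g \<in> S - {f}. \<exists>u\<in>lists Y. \<exists>v\<in>lists Y. t = u @ lm g @ v))"


section \<open>The free differential algebra on a set\<close>

text \<open>The letter \<open>x\<^sup>(\<^sup>n\<^sup>)\<close> is the pair \<open>(n, x)\<close>. In this component order the
  lexicographic order of \<^theory>\<open>HOL-Library.Product_Lexorder\<close> compares the order of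
  derivation first and then the variables.\<close>

definition Delta :: "'x set \<Rightarrow> (nat \<times> 'x) set" where
  "Delta X = UNIV \<times> X"

fun d_word :: "'k::field \<Rightarrow> (nat \<times> 'x) list \<Rightarrow> (nat \<times> 'x, 'k) ncpoly" where
  "d_word lam [] = 0"
| "d_word lam ((n, x) # u) =
     mon [(Suc n, x)] * mon u + mon [(n, x)] * d_word lam u
     + smul lam (mon [(Suc n, x)] * d_word lam u)"

definition dX :: "'k::field \<Rightarrow> (nat \<times> 'x, 'k) ncpoly \<Rightarrow> (nat \<times> 'x, 'k) ncpoly" where
  "dX lam = lin_ext (d_word lam)"

definition iX :: "('x, 'k::field) ncpoly \<Rightarrow> (nat \<times> 'x, 'k) ncpoly" where
  "iX = lin_ext (\<lambda>u. mon (map (Pair 0) u))"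

definition DI :: "'k::field \<Rightarrow> 'x set \<Rightarrow> (nat \<times> 'x, 'k) ncpoly set \<Rightarrow> (nat \<times> 'x, 'k) ncpoly set" where
  "DI lam X U = diff_ideal_gen (free_algebra (Delta X)) (dX lam) U"


section \<open>Differential Groebner-Shirshov bases\<close>

definition diff_trivial_mod ::
  "'k::field \<Rightarrow> 'x::linorder set \<Rightarrow> (nat \<times> 'x, 'k) ncpoly set \<Rightarrow> (nat \<times> 'x) list
     \<Rightarrow> (nat \<times> 'x, 'k) ncpoly \<Rightarrow> bool" where
  "diff_trivial_mod lam X S w h \<longleftrightarrow>
     (\<exists>ts :: ('k \<times> (nat \<times> 'x) list \<times> nat \<times> (nat \<times> 'x, 'k) ncpoly \<times> (nat \<times> 'x) list) list.
        (\<forall>(c, a, k, s, b) \<in> set ts.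
           s \<in> S \<and> a \<in> lists (Delta X) \<and> b \<in> lists (Delta X) \<and>
           (dX lam ^^ k) s \<noteq> 0 \<and> a @ lm ((dX lam ^^ k) s) @ b < w) \<and>
        h = (\<Sum>(c, a, k, s, b)\<leftarrow>ts. smul c (mon a * (dX lam ^^ k) s * mon b)))"

definition diff_GS_basis ::
  "'k::field \<Rightarrow> 'x::linorder set \<Rightarrow> (nat \<times> 'x, 'k) ncpoly set \<Rightarrow> bool" where
  "diff_GS_basis lam X S \<longleftrightarrow>
     S \<subseteq> free_algebra (Delta X) \<and> (\<forall>s\<in>S. monic s) \<and>
     (\<forall>f\<in>S. \<forall>g\<in>S. \<forall>i j. \<forall>u\<in>lists (Delta X). \<forall>v\<in>lists (Delta X). \<forall>w.
        let F = (dX lam ^^ i) f; G = (dX lam ^^ j) g in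
        F \<noteq> 0 \<longrightarrow> G \<noteq> 0 \<longrightarrow>
        (w = lm F @ u \<and> w = v @ lm G \<and> length w < length (lm f) + length (lm g)
           \<longrightarrow> diff_trivial_mod lam X S w (nrm F * mon u - mon v * nrm G)) \<and>
        (w = lm F \<and> w = u @ lm G @ v
           \<longrightarrow> diff_trivial_mod lam X S w (nrm F - mon u * nrm G * mon v)))"

definition diff_GS_basis_of ::
  "'k::field \<Rightarrow> 'x::linorder set \<Rightarrow> (nat \<times> 'x, 'k) ncpoly set
     \<Rightarrow> (nat \<times> 'x, 'k) ncpoly set \<Rightarrow> bool" where
  "diff_GS_basis_of lam X S I \<longleftrightarrow> diff_GS_basis lam X S \<and> DI lam X S = I"

definition diff_GS_minimal ::
  "'k::field \<Rightarrow> 'x::linorder set \<Rightarrow> (nat \<times> 'x, 'k) ncpoly set \<Rightarrow> bool" where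
  "diff_GS_minimal lam X S \<longleftrightarrow>
     (\<forall>f\<in>S. \<forall>g\<in>S. \<forall>i j. \<forall>a\<in>lists (Delta X). \<forall>b\<in>lists (Delta X).
        (dX lam ^^ i) f \<noteq> 0 \<longrightarrow> (dX lam ^^ j) g \<noteq> 0 \<longrightarrow>
        lm ((dX lam ^^ i) f) = a @ lm ((dX lam ^^ j) g) @ b \<longrightarrow>
        f = g \<and> i = j \<and> a = [] \<and> b = [])"

definition diff_GS_reduced ::
  "'k::field \<Rightarrow> 'x::linorder set \<Rightarrow> (nat \<times> 'x, 'k) ncpoly set \<Rightarrow> bool" where
  "diff_GS_reduced lam X S \<longleftrightarrow>
     (\<forall>f\<in>S. \<forall>t\<in>keys f.
        \<not> (\<exists>g \<in> S - {(dX lam ^^ i) f | i. True}. \<exists>j. \<exists>a\<in>lists (Delta X). \<exists>b\<in>lists (Delta X).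
             (dX lam ^^ j) g \<noteq> 0 \<and> t = a @ lm ((dX lam ^^ j) g) @ b))"


section \<open>Characterization of the explicit constructions\<close>

lemma lookup_smul [simp]: "lookup (smul c p) u = c * lookup p u"
  by (simp add: smul_def Poly_Mapping.map.rep_eq when_def)

lemma smul_conv_mult: "smul c p = Poly_Mapping.single [] c * p"
  unfolding smul_def mult_map_scale_conv_mult by (simp add: zero_list_def)


lemma ncpoly_expand: "p = (\<Sum>u\<in>keys p. smul (lookup p u) (mon u))"
  by (rule poly_mapping_eqI)
    (auto simp: lookup_sum mon_def lookup_single when_def in_keys_iff
      if_distrib [of "\<lambda>x. _ * x"] cong: if_cong)

lemma assoc_algebra_smul: "assoc_algebra (smul :: 'k::field \<Rightarrow> ('y, 'k) ncpoly \<Rightarrow> _)"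
proof
  fix c d :: 'k and p q :: "('y, 'k) ncpoly"
  show "smul c (p + q) = smul c p + smul c q"
    by (rule poly_mapping_eqI) (simp add: lookup_add algebra_simps)
  show "smul (c + d) p = smul c p + smul d p"
    by (rule poly_mapping_eqI) (simp add: lookup_add algebra_simps)
  show "smul c (smul d p) = smul (c * d) p"
    by (rule poly_mapping_eqI) (simp add: algebra_simps)
  show "smul 1 p = p"
    by (rule poly_mapping_eqI) simp
  show "smul c (p * q) = smul c p * q"
    by (simp add: smul_conv_mult algebra_simps)
  have comm: "Poly_Mapping.single [] c * p = p * Poly_Mapping.single [] c"
  proof -
    have "Poly_Mapping.single [] c * mon u = (mon u * Poly_Mapping.single [] c :: ('y, 'k) ncpoly)" for u
      by (simp add: mon_def mult_single plus_list_def)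
    moreover have "Poly_Mapping.single [] c * smul d q = smul d (Poly_Mapping.single [] c * q)"
      for d and q :: "('y, 'k) ncpoly"
      by (simp add: smul_conv_mult mult.assoc [symmetric] mult_single plus_list_def mult.commute)
    moreover have "smul d q * r = smul d (q * r)" for d and q r :: "('y, 'k) ncpoly"
      by (simp add: smul_conv_mult mult.assoc)
    ultimately show ?thesis
      by (subst (1 2) ncpoly_expand [of p]) (simp only: sum_distrib_left sum_distrib_right)
  qed
  then show "smul c (p * q) = p * smul c q"
    by (simp add: smul_conv_mult mult.assoc [symmetric])
qed

interpretation ncpoly: assoc_algebra "smul :: 'k::field \<Rightarrow> ('y, 'k) ncpoly \<Rightarrow> _"
  by (rule assoc_algebra_smul)

lemma mon_mult: "mon u * mon v = mon (u @ v)"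
  by (simp add: mon_def mult_single plus_list_def)

lemma mon_Nil: "mon [] = 1"
  by (metis mon_def single_one zero_list_def)

lemma lin_ext_superset:
  assumes "finite A" "keys p \<subseteq> A"
  shows "lin_ext F p = (\<Sum>u\<in>A. smul (lookup p u) (F u))"
  unfolding lin_ext_def using assms
  by (intro sum.mono_neutral_left) (auto simp: in_keys_iff)

lemma lin_ext_add: "lin_ext F (p + q) = lin_ext F p + lin_ext F q"
proof -
  let ?A = "keys p \<union> keys q"
  have "keys (p + q) \<subseteq> ?A" by (rule keys_add)
  then show ?thesis
    by (simp add: lin_ext_superset [of ?A] lookup_add ncpoly.scale_left_distrib sum.distrib)
qed

lemma lin_ext_smul: "lin_ext F (smul c p) = smul c (lin_ext F p)"
proof -
  have "keys (smul c p) \<subseteq> keys p" by (auto simp: in_keys_iff)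
  then show ?thesis
    by (simp add: lin_ext_superset [of "keys p"] ncpoly.scale_sum_right)
qed

lemma lin_ext_mon [simp]: "lin_ext F (mon u) = F u"
  by (simp add: lin_ext_def mon_def)

lemma lin_ext_0 [simp]: "lin_ext F 0 = 0"
  by (simp add: lin_ext_def)

lemma linear_ncpoly_sum:
  assumes "\<And>p q. h (p + q) = h p + (h q :: 'b::ab_group_add)"
  shows "h (sum g A) = (\<Sum>a\<in>A. h (g a))"
proof -
  have "h 0 = 0" using assms [of 0 0] by simp
  then show ?thesis
    by (induction A rule: infinite_finite_induct) (simp_all add: assms)
qed

lemma bilinear_ncpoly_eqI:
  fixes B C :: "('y, 'k::field) ncpoly \<Rightarrow> ('y, 'k) ncpoly \<Rightarrow> ('z, 'k) ncpoly"
  assumes "\<And>p p' q. B (p + p') q = B p q + B p' q" "\<And>p q q'. B p (q + q') = B p q + B p q'"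
    and "\<And>c p q. B (smul c p) q = smul c (B p q)" "\<And>c p q. B p (smul c q) = smul c (B p q)"
    and "\<And>p p' q. C (p + p') q = C p q + C p' q" "\<And>p q q'. C p (q + q') = C p q + C p q'"
    and "\<And>c p q. C (smul c p) q = smul c (C p q)" "\<And>c p q. C p (smul c q) = smul c (C p q)"
    and mon: "\<And>u v. B (mon u) (mon v) = C (mon u) (mon v)"
  shows "B p q = C p q"
proof -
  have *: "B (mon u) q = C (mon u) q" for u
  proof -
    have "B (mon u) (\<Sum>v\<in>A. smul (l v) (mon v)) = C (mon u) (\<Sum>v\<in>A. smul (l v) (mon v))" for l A
      by (simp add: linear_ncpoly_sum [of "B (mon u)"] linear_ncpoly_sum [of "C (mon u)"] assms)
    from this [of "lookup q" "keys q"] show ?thesis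
      by (simp only: ncpoly_expand [symmetric])
  qed
  have "B (\<Sum>v\<in>A. smul (l v) (mon v)) q = C (\<Sum>v\<in>A. smul (l v) (mon v)) q" for l A
    by (simp add: linear_ncpoly_sum [of "\<lambda>p. B p q"] linear_ncpoly_sum [of "\<lambda>p. C p q"] assms *)
  from this [of "lookup p" "keys p"] show ?thesis
    by (simp only: ncpoly_expand [symmetric])
qed

lemma d_word_append:
  fixes lam :: "'k::field" and u v :: "(nat \<times> 'x) list"
  shows "d_word lam (u @ v) = d_word lam u * mon v + mon u * d_word lam v
     + smul lam (d_word lam u * d_word lam v)"
proof (induction u)
  case Nil
  then show ?case by (simp add: mon_Nil)
next
  case (Cons a u)
  obtain n x where a: "a = (n, x)" by (cases a)
  have [simp]: "smul c p * q = smul c (p * q)" "p * smul c q = smul c (p * q)"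
    for c and p q :: "(nat \<times> 'x, 'k) ncpoly"
    by (simp_all add: ncpoly.scale_mult_left ncpoly.scale_mult_right [symmetric])
  have m: "mon (a # w) = mon [a] * (mon w :: (nat \<times> 'x, 'k) ncpoly)" for a w
    by (simp add: mon_mult)
  show ?case
    by (simp add: a Cons.IH m [of _ u] mon_mult [symmetric] algebra_simps ncpoly.scale_right_distrib)
qed

text \<open>\<^term>\<open>dX lam\<close> is the unique differential operator of weight \<^term>\<open>lam\<close> that sends
  \<open>x\<^sup>(\<^sup>n\<^sup>)\<close> to \<open>x\<^sup>(\<^sup>n\<^sup>+\<^sup>1\<^sup>)\<close>.\<close>

theorem differential_algebra_dX:
  fixes lam :: "'k::field"
  shows "differential_algebra smul lam (dX lam :: (nat \<times> 'x, 'k) ncpoly \<Rightarrow> _)"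
proof
  fix p q :: "(nat \<times> 'x, 'k) ncpoly" and c
  show "dX lam (p + q) = dX lam p + dX lam q"
    by (simp add: dX_def lin_ext_add)
  show "dX lam (smul c p) = smul c (dX lam p)"
    by (simp add: dX_def lin_ext_smul)
  have sm: "smul c p * q = smul c (p * q)" "p * smul c q = smul c (p * q)"
    for c and p q :: "(nat \<times> 'x, 'k) ncpoly"
    using ncpoly.scale_mult_left [of c p q] ncpoly.scale_mult_right [of c p q] by simp_all
  have add: "dX lam (p + q) = dX lam p + dX lam q"
    and smul: "dX lam (smul c p) = smul c (dX lam p)"
    for c and p q :: "(nat \<times> 'x, 'k) ncpoly"
    by (simp_all add: dX_def lin_ext_add lin_ext_smul)
  show "dX lam (p * q) = dX lam p * q + p * dX lam q + smul lam (dX lam p * dX lam q)"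
    by (rule bilinear_ncpoly_eqI [of "\<lambda>p q. dX lam (p * q)"
          "\<lambda>p q. dX lam p * q + p * dX lam q + smul lam (dX lam p * dX lam q)"])
      (simp_all add: add smul sm distrib_left distrib_right ncpoly.scale_right_distrib mult.commute,
       simp add: dX_def mon_mult d_word_append)
  show "dX lam 1 = (0 :: (nat \<times> 'x, 'k) ncpoly)"
    by (simp add: dX_def mon_Nil [symmetric])
qed

lemma dX_letter: "dX lam (mon [(n, x)]) = mon [(Suc n, x)]"
  by (simp add: dX_def mon_Nil)

theorem dX_unique:
  assumes "differential_algebra smul lam D" and D: "\<And>n x. D (mon [(n, x)]) = mon [(Suc n, x)]"
  shows "D = dX lam"
proof
  interpret differential_algebra smul lam D by fact
  have *: "D (mon u) = dX lam (mon u)" for u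
  proof (induction u)
    case Nil
    show ?case by (simp only: mon_Nil d_one differential_algebra.d_one [OF differential_algebra_dX])
  next
    case (Cons a u)
    obtain n x where a: "a = (n, x)" by (cases a)
    have m: "mon (a # u) = mon [(n, x)] * mon u"
      by (simp add: a mon_mult)
    show ?case
      unfolding m d_mult Cons.IH D
        differential_algebra.d_mult [OF differential_algebra_dX] dX_letter ..
  qed
  fix p
  have "D (\<Sum>u\<in>A. smul (l u) (mon u)) = dX lam (\<Sum>u\<in>A. smul (l u) (mon u))" for l A
    by (simp add: linear_ncpoly_sum [of D] linear_ncpoly_sum [of "dX lam"] d_add d_scale *
        differential_algebra.d_add [OF differential_algebra_dX]
        differential_algebra.d_scale [OF differential_algebra_dX])
  from this [of "lookup p" "keys p"] show "D p = dX lam p"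
    by (simp only: ncpoly_expand [symmetric])
qed

lemma free_algebra_0: "0 \<in> free_algebra Y"
  by (simp add: free_algebra_def)

lemma free_algebra_1: "1 \<in> free_algebra Y"
  by (simp add: free_algebra_def zero_list_def)

lemma free_algebra_smul: "p \<in> free_algebra Y \<Longrightarrow> smul c p \<in> free_algebra Y"
  by (auto simp: free_algebra_def in_keys_iff)

lemma free_algebra_add: "p \<in> free_algebra Y \<Longrightarrow> q \<in> free_algebra Y \<Longrightarrow> p + q \<in> free_algebra Y"
  using keys_add [of p q] by (auto simp: free_algebra_def)

lemma free_algebra_mult: "p \<in> free_algebra Y \<Longrightarrow> q \<in> free_algebra Y \<Longrightarrow> p * q \<in> free_algebra Y"
  using keys_mult [of p q] by (fastforce simp: free_algebra_def plus_list_def)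

lemma free_algebra_mon: "u \<in> lists Y \<Longrightarrow> mon u \<in> free_algebra Y"
  by (simp add: free_algebra_def mon_def)

lemma free_algebra_lin_ext:
  fixes p :: "('y, 'k::field) ncpoly" and F :: "'y list \<Rightarrow> ('z, 'k) ncpoly"
  assumes "\<And>u. u \<in> lists Y \<Longrightarrow> F u \<in> free_algebra Z" "p \<in> free_algebra Y"
  shows "lin_ext F p \<in> free_algebra Z"
proof -
  have "sum g A \<in> free_algebra Z" if "\<And>a. a \<in> A \<Longrightarrow> g a \<in> free_algebra Z" for A and g :: "'y list \<Rightarrow> ('z, 'k) ncpoly"
    using that
    by (induction A rule: infinite_finite_induct) (auto intro: free_algebra_add free_algebra_0)
  moreover have "smul (lookup p u) (F u) \<in> free_algebra Z" if "u \<in> keys p" for u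
    using that assms by (intro free_algebra_smul assms(1)) (auto simp: free_algebra_def)
  ultimately show ?thesis
    unfolding lin_ext_def by simp
qed

lemma dX_free_algebra: "p \<in> free_algebra (Delta X) \<Longrightarrow> dX lam p \<in> free_algebra (Delta X)"
  unfolding dX_def
proof (rule free_algebra_lin_ext)
  show "d_word lam u \<in> free_algebra (Delta X)" if "u \<in> lists (Delta X)" for u
    using that
    by (induction lam u rule: d_word.induct)
      (auto simp: Delta_def
        intro!: free_algebra_0 free_algebra_add free_algebra_mult free_algebra_smul free_algebra_mon)
qed

theorem alg_hom_on_iX:
  "alg_hom_on UNIV smul smul (iX :: ('x, 'k::field) ncpoly \<Rightarrow> _)"
  unfolding alg_hom_on_def
proof (intro conjI ballI allI)
  fix p q :: "('x, 'k) ncpoly" and c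
  show "iX (p + q) = iX p + iX q"
    by (simp add: iX_def lin_ext_add)
  show "iX (smul c p) = smul c (iX p)"
    by (simp add: iX_def lin_ext_smul)
  have sm: "smul c p * q = smul c (p * q)" "p * smul c q = smul c (p * q)"
    for c and p q :: "('y, 'k) ncpoly"
    using ncpoly.scale_mult_left [of c p q] ncpoly.scale_mult_right [of c p q] by simp_all
  show "iX (p * q) = iX p * iX q"
    by (rule bilinear_ncpoly_eqI [of "\<lambda>p q. iX (p * q)" "\<lambda>p q. iX p * iX q"])
      (simp_all add: iX_def lin_ext_add lin_ext_smul sm distrib_left distrib_right mon_mult)
  show "iX 1 = (1 :: (nat \<times> 'x, 'k) ncpoly)"
    by (simp add: iX_def mon_Nil [symmetric])
qed

lemma iX_letter: "iX (mon [x]) = mon [(0, x)]"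
  by (simp add: iX_def)

lemma lookup_iX: "lookup (iX p) (map (Pair 0) u) = lookup p u"
proof -
  have "map (Pair (0::nat)) v = map (Pair 0) u \<longleftrightarrow> v = u" for v
    by (auto simp: inj_map_eq_map inj_on_def)
  then show ?thesis
    by (auto simp: iX_def lin_ext_def lookup_sum mon_def lookup_single when_def in_keys_iff
      if_distrib [of "\<lambda>x. _ * x"] cong: if_cong)
qed

lemma inj_iX: "inj iX"
  by (rule injI) (metis lookup_iX poly_mapping_eqI)

lemma iX_free_algebra: "p \<in> free_algebra X \<Longrightarrow> iX p \<in> free_algebra (Delta X)"
  unfolding iX_def
  by (rule free_algebra_lin_ext) (auto simp: Delta_def intro!: free_algebra_mon)

end

theory Submission
  imports Defs
begin

text \<open>The derivation raises the order of the first letter of the leading word (\<open>lam = 0\<close>) or of all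
  its letters (\<open>lam \<noteq> 0\<close>), an operation that is strictly monotone for deg-lex. Hence, with \<open>up\<close> for this
  operation, \<open>d\<close> maps polynomials that are trivial modulo \<open>w\<close> to ones that are trivial modulo \<open>up w\<close>,
  and modulo these \<open>d (a d\<^sup>k(s) b)\<close> is a nonzero multiple of one element of the same form. The orders
  of the letters in the leading words of \<open>d\<^sup>i(f)\<close> and \<open>d\<^sup>j(g)\<close> force every overlap of them to be the
  image under \<open>up\<^sup>i\<close> of an overlap of the leading words of \<open>f\<close> and \<open>g\<close>; applying \<open>d\<^sup>i\<close> to the
  trivial composition of \<open>f\<close> and \<open>g\<close> therefore yields the required one.\<close>

section \<open>Leading terms\<close>

text \<open>Suffixes of equal length leave the length comparison to \<open>u\<close> and
  \<open>u'\<close>; for those of equal length the first difference decides.\<close>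

lemma append_less_append:
  fixes u u' v v' :: "'y::linorder list"
  shows "u < u' \<Longrightarrow> length v = length v' \<Longrightarrow> u @ v < u' @ v'"
  by (auto simp: list_less_def intro: lenlex_append1)

lemma append_less_append_left:
  fixes u v v' :: "'y::linorder list"
  shows "v < v' \<Longrightarrow> u @ v < u @ v'"
  by (simp add: list_less_def irrefl_def)

lemma append_le_append:
  fixes u u' v v' :: "'y::linorder list"
  assumes "u \<le> u'" "v \<le> v'"
  shows "u @ v \<le> u' @ v'"
proof -
  have len: "length x \<le> length y" if "x \<le> y" for x y :: "'y list"
    using that lenlex_length by (fastforce simp: list_le_def list_less_def)
  have 1: "u @ v \<le> u @ v'"
    using assms(2) append_less_append_left[of v v' u] by (auto simp: list_le_def)
  have "u @ v' \<le> u' @ v'"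
    using assms(1) append_less_append[of u u' v' v'] by (auto simp: list_le_def)
  with 1 show ?thesis by (rule order_trans)
qed

lemma append_less_append_le:
  fixes u u' v v' :: "'y::linorder list"
  assumes "u < u'" "v \<le> v'"
  shows "u @ v < u' @ v'"
  using append_less_append[of u u' v v] append_le_append[of u' u' v v'] assms
  by (metis order.strict_trans2 order_refl)

section \<open>Supports, products and leading coefficients\<close>

lemma keys_smul: "keys (smul c p) \<subseteq> keys p"
  by (auto simp: in_keys_iff)

lemma smul_mult [simp]:
  "smul c p * q = smul c (p * q)" "p * smul c q = smul c (p * (q :: ('y, 'k::field) ncpoly))"
  using ncpoly.scale_mult_left[of c p q] ncpoly.scale_mult_right[of c p q] by simp_all

lemma keys_mon [simp]: "keys (mon u :: ('y, 'k::field) ncpoly) = {u}"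
  by (simp add: mon_def)

lemma lookup_mon: "lookup (mon u :: ('y, 'k::field) ncpoly) v = (if u = v then 1 else 0)"
  by (simp add: mon_def lookup_single when_def)

lemma keys_mult_append:
  fixes p q :: "('y, 'k::field) ncpoly"
  assumes "w \<in> keys (p * q)"
  obtains u v where "u \<in> keys p" "v \<in> keys q" "w = u @ v"
  using assms keys_mult[of p q] by (auto simp: plus_list_def)

text \<open>The coefficient \<open>c\<close> may be zero; then all monomials lie strictly below
  \<open>w\<close>. Leading terms thus add and multiply without case distinctions about
  cancellation.\<close>

definition lead :: "('y::linorder, 'k::field) ncpoly \<Rightarrow> 'y list \<Rightarrow> 'k \<Rightarrow> bool" where
  "lead p w c \<longleftrightarrow> lookup p w = c \<and> (\<forall>v\<in>keys p. v \<le> w)"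

lemma lead_lm: "p \<noteq> 0 \<Longrightarrow> lead p (lm p) (lc p)"
  by (simp add: lead_def lc_def lm_def)

lemma lc_nonzero: "p \<noteq> 0 \<Longrightarrow> lc p \<noteq> 0"
  unfolding lc_def lm_def using Max_in[of "keys p"] by (simp add: in_keys_iff)

lemma lead_imp:
  assumes "lead p w c" "c \<noteq> 0"
  shows "p \<noteq> 0" "lm p = w" "lc p = c"
proof -
  have w: "w \<in> keys p" using assms by (auto simp: lead_def in_keys_iff)
  then show "p \<noteq> 0" by auto
  show *: "lm p = w"
    unfolding lm_def using w assms by (intro Max_eqI) (auto simp: lead_def)
  show "lc p = c" using assms by (simp add: lc_def * lead_def)
qed

lemma lead_mon: "lead (mon u) u 1"
  by (simp add: lead_def lookup_mon)

lemma lead_smul: "lead p w c \<Longrightarrow> lead (smul a p) w (a * c)"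
  by (auto simp: lead_def in_keys_iff)

lemma lead_add: "lead p w a \<Longrightarrow> lead q w b \<Longrightarrow> lead (p + q) w (a + b)"
  using keys_add[of p q] by (fastforce simp: lead_def lookup_add)

lemma keys_minus_subset: "keys (p - q :: ('y, 'k::field) ncpoly) \<subseteq> keys p \<union> keys q"
  by (auto simp: in_keys_iff lookup_minus)

lemma lead_remainder:
  assumes "lead p w c" "v \<in> keys (p - smul c (mon w))"
  shows "v < w"
proof -
  have "v \<noteq> w" using assms by (auto simp: in_keys_iff lookup_minus lookup_mon lead_def)
  moreover have "v \<in> keys p"
    using assms \<open>v \<noteq> w\<close> by (auto simp: in_keys_iff lookup_minus lookup_mon)
  ultimately show ?thesis using assms by (force simp: lead_def)
qed

lemma lead_lower: "(\<And>v. v \<in> keys p \<Longrightarrow> v < w) \<Longrightarrow> lead p w 0"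
  by (force simp: lead_def in_keys_iff)

text \<open>Splitting off the leading terms leaves strictly smaller monomials; deg-lex respects
  concatenation on both sides, so every other product falls below \<open>u @ v\<close>.\<close>

lemma lead_mult:
  fixes p q :: "('y::linorder, 'k::field) ncpoly"
  assumes p: "lead p u c" and q: "lead q v d"
  shows "lead (p * q) (u @ v) (c * d)"
proof -
  define p' where "p' = p - smul c (mon u)"
  define q' where "q' = q - smul d (mon v)"
  have p': "x < u" if "x \<in> keys p'" for x
    using lead_remainder[OF p] that by (simp add: p'_def)
  have q': "x < v" if "x \<in> keys q'" for x
    using lead_remainder[OF q] that by (simp add: q'_def)
  have eq: "p * q = smul (c * d) (mon (u @ v)) + (smul c (mon u * q') + p' * q)"
    by (simp add: p'_def q'_def algebra_simps mon_mult ncpoly.scale_right_diff_distrib)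
  have 1: "lead (smul c (mon u * q')) (u @ v) 0"
  proof (rule lead_lower)
    fix x assume "x \<in> keys (smul c (mon u * q'))"
    then have "x \<in> keys (mon u * q')" using keys_smul by blast
    then show "x < u @ v"
      by (rule keys_mult_append) (auto intro: append_less_append_left q')
  qed
  have 2: "lead (p' * q) (u @ v) 0"
  proof (rule lead_lower)
    fix x assume "x \<in> keys (p' * q)"
    then obtain a b where "a \<in> keys p'" "b \<in> keys q" "x = a @ b"
      by (rule keys_mult_append)
    then show "x < u @ v"
      using p' q by (auto simp: lead_def intro: append_less_append_le)
  qed
  have "lead (p * q) (u @ v) (c * d * 1 + (0 + 0))"
    unfolding eq by (intro lead_add lead_smul lead_mon 1 2)
  then show ?thesis by simp
qed


section \<open>The leading term of a derivative\<close>

text \<open>All words of \<open>d_word lam u\<close> have the length of \<open>u\<close> and are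
  compared lexicographically, orders of derivation first. For \<open>lam = 0\<close> each has one
  letter raised, and raising the first one wins; otherwise the word with all letters raised occurs
  and wins.\<close>

fun up :: "'k::field \<Rightarrow> (nat \<times> 'x) list \<Rightarrow> (nat \<times> 'x) list" where
  "up lam [] = []"
| "up lam ((n, x) # u) = (Suc n, x) # (if lam = 0 then u else map (apfst Suc) u)"

lemma up_nonzero: "lam \<noteq> 0 \<Longrightarrow> up lam u = map (apfst Suc) u"
  by (cases u) auto

lemma up_append_0: "u \<noteq> [] \<Longrightarrow> up (0 :: 'k::field) (u @ v) = up (0 :: 'k) u @ v"
  by (cases u) auto

lemma length_up [simp]: "length (up lam u) = length u"
  by (induction lam u rule: up.induct) auto

lemma up_eq_Nil [simp]: "up lam u = [] \<longleftrightarrow> u = []"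
  by (metis length_0_conv length_up)

text \<open>Lengths do not change, and raising two letters preserves their order and equality, so
  the first difference decides as before.\<close>

lemma up_mono: "u < v \<Longrightarrow> up lam u < up lam (v :: (nat \<times> 'x::linorder) list)"
proof (cases "lam = 0")
  case True
  then show "u < v \<Longrightarrow> ?thesis"
    by (cases u; cases v) (auto simp: Cons_less_Cons)
next
  case False
  have "map (apfst Suc) u < map (apfst Suc) v" if "u < v"
    using that
  proof (induction u arbitrary: v)
    case Nil
    then show ?case by (cases v) auto
  next
    case (Cons a u)
    then show ?case by (cases a; cases v) (auto simp: Cons_less_Cons)
  qed
  then show "u < v \<Longrightarrow> ?thesis" using False by (simp add: up_nonzero)
qed

lemma less_up: "u \<noteq> [] \<Longrightarrow> u < up lam (u :: (nat \<times> 'x::linorder) list)"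
  by (cases u) (auto simp: Cons_less_Cons)

lemma lists_Delta_iff: "u \<in> lists (Delta X) \<longleftrightarrow> map snd u \<in> lists X"
  by (induction u) (auto simp: Delta_def)

lemma map_snd_up [simp]: "map snd (up lam u) = map snd u"
  by (induction lam u rule: up.induct) auto

lemma up_lists: "u \<in> lists (Delta X) \<Longrightarrow> up lam u \<in> lists (Delta X)"
  unfolding lists_Delta_iff by simp

section \<open>Derivatives of words and their leading terms\<close>

lemma dX_add: "dX lam (p + q) = dX lam p + dX lam q"
  by (simp add: dX_def lin_ext_add)

lemma dX_smul: "dX lam (smul c p) = smul c (dX lam p)"
  by (simp add: dX_def lin_ext_smul)

lemma dX_0 [simp]: "dX lam 0 = 0"
  by (simp add: dX_def)

lemma dX_diff: "dX lam (p - q) = dX lam p - dX lam q"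
  by (metis add_diff_cancel_right' diff_add_cancel dX_add)

lemma dX_mult: "dX lam (p * q) = dX lam p * q + p * dX lam q + smul lam (dX lam p * dX lam q)"
  by (rule differential_algebra.d_mult[OF differential_algebra_dX])

lemma dX_1 [simp]: "dX lam 1 = 0"
  by (rule differential_algebra.d_one[OF differential_algebra_dX])

lemma dX_mon: "dX lam (mon u) = d_word lam u"
  by (simp add: dX_def)

lemma keys_dX:
  assumes "v \<in> keys (dX lam p)"
  obtains u where "u \<in> keys p" "v \<in> keys (d_word lam u)"
proof -
  have "\<exists>u\<in>keys p. v \<in> keys (smul (lookup p u) (d_word lam u))"
    using assms keys_sum[of "\<lambda>u. smul (lookup p u) (d_word lam u)" "keys p"]
    unfolding dX_def lin_ext_def by blast
  then show thesis using keys_smul that by blast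
qed

lemma length_keys_d_word: "v \<in> keys (d_word (lam :: 'k::field) u) \<Longrightarrow> length v = length u"
proof (induction lam u arbitrary: v rule: d_word.induct)
  case (2 lam n x u)
  let ?d = "d_word lam u"
  have "v \<in> keys (mon [(Suc n, x)] * mon u :: (nat \<times> 'a, 'k) ncpoly) \<or> v \<in> keys (mon [(n, x)] * ?d)
      \<or> v \<in> keys (mon [(Suc n, x)] * ?d)"
    using 2(3) by (auto simp: in_keys_iff lookup_add)
  then show ?case
    by (auto elim!: keys_mult_append dest: 2(1,2))
qed simp

text \<open>For \<open>lam \<noteq> 0\<close> the operator \<open>E = id + lam d\<close> is multiplicative, which makes its effect on
  words, and hence that of \<open>d\<close>, easy to control.\<close>

definition E :: "'k::field \<Rightarrow> (nat \<times> 'x, 'k) ncpoly \<Rightarrow> (nat \<times> 'x, 'k) ncpoly" where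
  "E lam p = p + smul lam (dX lam p)"

lemma E_mult: "E lam (p * q) = E lam p * E lam q"
  by (simp add: E_def dX_mult algebra_simps ncpoly.scale_right_distrib)

lemma E_1 [simp]: "E lam 1 = 1"
  by (simp add: E_def)

text \<open>A letter of order \<open>n\<close> goes to itself plus \<open>lam\<close> times the
  letter of order \<open>Suc n\<close>, and the latter leads; multiplicativity does the
  rest.\<close>

lemma lead_E_mon:
  fixes lam :: "'k::field" and u :: "(nat \<times> 'x::linorder) list"
  assumes "lam \<noteq> 0"
  shows "lead (E lam (mon u)) (up lam u) (lam ^ length u)"
proof (induction u)
  case Nil
  then show ?case using lead_mon[of "[]"] by (simp add: mon_Nil)
next
  case (Cons a u)
  obtain n x where a: "a = (n, x)" by (cases a)
  have eq: "E lam (mon (a # u)) = E lam (mon [(n, x)]) * E lam (mon u)"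
    by (simp add: a mon_mult flip: E_mult)
  have "lead (mon [(n, x)] :: (nat \<times> 'x, 'k) ncpoly) [(Suc n, x)] 0"
    by (rule lead_lower) (simp add: Cons_less_Cons)
  then have "lead (E lam (mon [(n, x)])) [(Suc n, x)] (0 + lam * 1)"
    unfolding E_def dX_letter by (intro lead_add lead_smul lead_mon)
  from lead_mult[OF this Cons] show ?case
    using assms by (simp only: eq) (simp add: a up_nonzero)
qed

text \<open>The Leibniz rule gives the word with its first letter raised plus terms of the same
  length that still start with the old first letter; these are smaller.\<close>

lemma lead_d_word_0:
  fixes u :: "(nat \<times> 'x::linorder) list"
  assumes "u \<noteq> []"
  shows "lead (d_word (0 :: 'k::field) u) (up (0 :: 'k) u) 1"
proof -
  obtain n x v where u: "u = (n, x) # v" using assms by (metis neq_Nil_conv surj_pair)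
  have "lead (mon [(n, x)] * d_word 0 v :: (nat \<times> 'x, 'k) ncpoly) (up (0 :: 'k) u) 0"
    by (rule lead_lower)
      (auto elim!: keys_mult_append simp: u Cons_less_Cons dest: length_keys_d_word)
  then have "lead (mon (up (0 :: 'k) u) + mon [(n, x)] * d_word 0 v) (up (0 :: 'k) u) (1 + 0 :: 'k)"
    by (intro lead_add lead_mon)
  then show ?thesis
    by (simp add: u mon_mult)
qed

text \<open>For \<open>lam \<noteq> 0\<close> the derivative is \<open>1/lam\<close> times the
  difference of \<open>E lam (mon u)\<close> and \<open>mon u\<close>, and \<open>u\<close> lies
  below \<open>up lam u\<close>. Later only \<open>c \<noteq> 0\<close> matters.\<close>

lemma lead_d_word:
  fixes lam :: "'k::field" and u :: "(nat \<times> 'x::linorder) list"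
  assumes "u \<noteq> []"
  obtains c where "c \<noteq> 0" "lead (d_word lam u) (up lam u) c"
proof (cases "lam = 0")
  case True
  then show thesis using that[of 1] lead_d_word_0[OF assms] by simp
next
  case False
  have "lead (mon u :: (nat \<times> 'x, 'k) ncpoly) (up lam u) 0"
    using less_up[OF assms] by (intro lead_lower) auto
  then have "lead (smul (1/lam) (E lam (mon u) + smul (-1) (mon u))) (up lam u)
      (1/lam * (lam ^ length u + (-1) * 0))"
    by (intro lead_add lead_smul lead_E_mon False)
  moreover have "smul (1/lam) (E lam (mon u) + smul (-1) (mon u)) = d_word lam u"
    using False by (simp add: E_def dX_mon)
  ultimately show thesis using False that[of "lam ^ length u / lam"] by simp
qed

lemma keys_d_word_le: "v \<in> keys (d_word lam u) \<Longrightarrow> v \<le> up lam (u :: (nat \<times> 'x::linorder) list)"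
  by (cases "u = []") (auto elim: lead_d_word[of u lam] simp: lead_def)

text \<open>Nonzero constants are killed by the derivation, so the leading word must be nonempty. By
  \<open>up_mono\<close> the derivatives of the lower monomials stay below
  \<open>up lam (lm p)\<close> and cannot cancel its coefficient.\<close>

lemma
  fixes p :: "(nat \<times> 'x::linorder, 'k::field) ncpoly"
  assumes "p \<noteq> 0" "lm p \<noteq> []"
  shows dX_nonzero: "dX lam p \<noteq> 0" and lm_dX: "lm (dX lam p) = up lam (lm p)"
proof -
  obtain c where c: "c \<noteq> 0" "lead (d_word lam (lm p)) (up lam (lm p)) c"
    using lead_d_word assms(2) .
  define p' where "p' = p - smul (lc p) (mon (lm p))"
  have "lead (dX lam p') (up lam (lm p)) 0"
  proof (rule lead_lower)
    fix v assume "v \<in> keys (dX lam p')"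
    then obtain u where u: "u \<in> keys p'" "v \<in> keys (d_word lam u)" by (rule keys_dX)
    then have "u < lm p" using lead_remainder[OF lead_lm] assms by (auto simp: p'_def)
    then show "v < up lam (lm p)" using keys_d_word_le[OF u(2)] up_mono
      by (metis order.strict_trans1)
  qed
  moreover have "dX lam p = smul (lc p) (d_word lam (lm p)) + dX lam p'"
    by (simp add: p'_def dX_diff dX_smul dX_mon)
  ultimately have "lead (dX lam p) (up lam (lm p)) (lc p * c + 0)"
    by (simp only:) (intro lead_add lead_smul c)
  moreover have "lc p * c + 0 \<noteq> 0"
    using lc_nonzero assms c by simp
  ultimately show "dX lam p \<noteq> 0" "lm (dX lam p) = up lam (lm p)"
    by (rule lead_imp)+
qed


section \<open>Polynomials that are trivial modulo a word\<close>

text \<open>As a linear span the trivial elements get closure rules and induction. The arbitrary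
  index type serves the ordinary and the differential notion alike.\<close>

lemma combination_iff_span:
  fixes g :: "'i \<Rightarrow> ('y, 'k::field) ncpoly"
  shows "(\<exists>ts. (\<forall>(c, x) \<in> set ts. x \<in> A) \<and> h = (\<Sum>(c, x)\<leftarrow>ts. smul c (g x))) \<longleftrightarrow>
    h \<in> ncpoly.span (g ` A)"
proof
  assume "\<exists>ts. (\<forall>(c, x) \<in> set ts. x \<in> A) \<and> h = (\<Sum>(c, x)\<leftarrow>ts. smul c (g x))"
  then obtain ts where "\<forall>(c, x) \<in> set ts. x \<in> A" "h = (\<Sum>(c, x)\<leftarrow>ts. smul c (g x))"
    by blast
  then show "h \<in> ncpoly.span (g ` A)"
    by (induction ts arbitrary: h)
      (auto intro!: ncpoly.span_zero ncpoly.span_add ncpoly.span_scale intro: ncpoly.span_base)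
next
  assume "h \<in> ncpoly.span (g ` A)"
  then show "\<exists>ts. (\<forall>(c, x) \<in> set ts. x \<in> A) \<and> h = (\<Sum>(c, x)\<leftarrow>ts. smul c (g x))"
  proof (induction rule: ncpoly.span_induct_alt)
    case base
    show ?case by (rule exI[of _ "[]"]) simp
  next
    case (step c p q)
    then obtain x ts where "x \<in> A" "p = g x" "\<forall>(c, x) \<in> set ts. x \<in> A"
      "q = (\<Sum>(c, x)\<leftarrow>ts. smul c (g x))"
      by blast
    then show ?case by (intro exI[of _ "(c, x) # ts"]) simp
  qed
qed

definition trivial_span ::
  "'k::field \<Rightarrow> 'x::linorder set \<Rightarrow> (nat \<times> 'x, 'k) ncpoly set \<Rightarrow> (nat \<times> 'x) list
     \<Rightarrow> (nat \<times> 'x, 'k) ncpoly set" where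
  "trivial_span lam X S w = ncpoly.span
     ((\<lambda>(a, k, s, b). mon a * (dX lam ^^ k) s * mon b) `
        {(a, k, s, b). s \<in> S \<and> a \<in> lists (Delta X) \<and> b \<in> lists (Delta X) \<and>
           (dX lam ^^ k) s \<noteq> 0 \<and> a @ lm ((dX lam ^^ k) s) @ b < w})"

lemma diff_trivial_mod_iff: "diff_trivial_mod lam X S w h \<longleftrightarrow> h \<in> trivial_span lam X S w"
  unfolding trivial_span_def diff_trivial_mod_def combination_iff_span[symmetric]
  by (simp add: case_prod_unfold)

lemma trivial_mod_iff:
  "trivial_mod Y S w h \<longleftrightarrow> h \<in> ncpoly.span ((\<lambda>(a, s, b). mon a * s * mon b) `
     {(a, s, b). s \<in> S \<and> a \<in> lists Y \<and> b \<in> lists Y \<and> a @ lm s @ b < w})"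
  unfolding trivial_mod_def combination_iff_span[symmetric]
  by (simp add: case_prod_unfold)

lemma trivial_span_base:
  assumes "s \<in> S" "a \<in> lists (Delta X)" "b \<in> lists (Delta X)"
    "(dX lam ^^ k) s \<noteq> 0" "a @ lm ((dX lam ^^ k) s) @ b < w"
  shows "mon a * (dX lam ^^ k) s * mon b \<in> trivial_span lam X S w"
  unfolding trivial_span_def
  by (rule ncpoly.span_base, rule image_eqI[of _ _ "(a, k, s, b)"]) (use assms in auto)

lemma trivial_span_induct [consumes 1, case_names zero step]:
  assumes "h \<in> trivial_span lam X S w" and "P 0"
    and "\<And>c a k s b q. s \<in> S \<Longrightarrow> a \<in> lists (Delta X) \<Longrightarrow> b \<in> lists (Delta X) \<Longrightarrow>
      (dX lam ^^ k) s \<noteq> 0 \<Longrightarrow> a @ lm ((dX lam ^^ k) s) @ b < w \<Longrightarrow> P q \<Longrightarrow>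
      P (smul c (mon a * (dX lam ^^ k) s * mon b) + q)"
  shows "P h"
  using assms(1) unfolding trivial_span_def
  by (induction rule: ncpoly.span_induct_alt) (auto intro: assms(2,3))

lemma trivial_span_mono: "w \<le> w' \<Longrightarrow> trivial_span lam X S w \<subseteq> trivial_span lam X S w'"
  unfolding trivial_span_def by (intro ncpoly.span_mono image_mono) auto

lemma trivial_span_closed:
  "0 \<in> trivial_span lam X S w"
  "p \<in> trivial_span lam X S w \<Longrightarrow> q \<in> trivial_span lam X S w \<Longrightarrow> p + q \<in> trivial_span lam X S w"
  "p \<in> trivial_span lam X S w \<Longrightarrow> q \<in> trivial_span lam X S w \<Longrightarrow> p - q \<in> trivial_span lam X S w"
  "p \<in> trivial_span lam X S w \<Longrightarrow> smul c p \<in> trivial_span lam X S w"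
  "(\<And>i. i \<in> I \<Longrightarrow> f i \<in> trivial_span lam X S w) \<Longrightarrow> sum f I \<in> trivial_span lam X S w"
  unfolding trivial_span_def
  by (auto intro: ncpoly.span_zero ncpoly.span_add ncpoly.span_diff ncpoly.span_scale ncpoly.span_sum)

text \<open>Each generator has its leading monomial below \<open>w\<close>, by
  \<open>lead_mult\<close>. In particular \<open>w\<close> never occurs in a trivial element, which
  later identifies two unknown scalars.\<close>

lemma keys_trivial_span:
  fixes h :: "(nat \<times> 'x::linorder, 'k::field) ncpoly"
  assumes "h \<in> trivial_span lam X S w" "v \<in> keys h"
  shows "v < w"
  using assms
proof (induction arbitrary: v rule: trivial_span_induct)
  case (step c a k s b q)
  let ?F = "(dX lam ^^ k) s"
  have "lead (mon a * ?F * mon b) ((a @ lm ?F) @ b) (1 * lc ?F * 1)"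
    by (intro lead_mult lead_mon lead_lm step)
  then have "v < w" if "v \<in> keys (mon a * ?F * mon b)"
    using that step(5) by (auto simp: lead_def)
  then show ?case
    using step(6)[of v] step(7)
    by (cases "v \<in> keys (mon a * ?F * mon b)") (auto simp: in_keys_iff lookup_add)
qed simp

text \<open>Expanding \<open>P\<close> and \<open>Q\<close> into words gives generators of the span.
  The error terms of the Leibniz rule have this shape.\<close>

lemma trivial_span_mult:
  fixes P Q :: "(nat \<times> 'x::linorder, 'k::field) ncpoly"
  assumes s: "s \<in> S" "(dX lam ^^ k) s \<noteq> 0"
    and PQ: "P \<in> free_algebra (Delta X)" "Q \<in> free_algebra (Delta X)"
    and less: "\<And>a b. a \<in> keys P \<Longrightarrow> b \<in> keys Q \<Longrightarrow> a @ lm ((dX lam ^^ k) s) @ b < w"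
  shows "P * (dX lam ^^ k) s * Q \<in> trivial_span lam X S w"
proof -
  let ?F = "(dX lam ^^ k) s"
  have "(\<Sum>a\<in>keys P. smul (lookup P a) (mon a)) * ?F * (\<Sum>b\<in>keys Q. smul (lookup Q b) (mon b))
      = (\<Sum>b\<in>keys Q. \<Sum>a\<in>keys P. smul (lookup Q b) (smul (lookup P a) (mon a * ?F * mon b)))"
    by (simp add: sum_distrib_left sum_distrib_right ncpoly.scale_sum_right)
  also have "\<dots> \<in> trivial_span lam X S w"
    using PQ less by (intro trivial_span_closed trivial_span_base s) (auto simp: free_algebra_def)
  finally show ?thesis by (simp flip: ncpoly_expand)
qed


section \<open>Iterated derivatives and derivatives of generators\<close>

lemma free_algebra_diff: "p \<in> free_algebra Y \<Longrightarrow> q \<in> free_algebra Y \<Longrightarrow> p - q \<in> free_algebra Y"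
  using keys_minus_subset[of p q] by (auto simp: free_algebra_def)

lemma free_algebra_E: "p \<in> free_algebra (Delta X) \<Longrightarrow> E lam p \<in> free_algebra (Delta X)"
  unfolding E_def by (intro free_algebra_add free_algebra_smul dX_free_algebra)

lemma
  fixes s :: "(nat \<times> 'x::linorder, 'k::field) ncpoly"
  assumes "s \<noteq> 0" "lm s \<noteq> []"
  shows iterate_dX_nonzero: "(dX lam ^^ k) s \<noteq> 0" and lm_iterate_dX_nonempty: "lm ((dX lam ^^ k) s) \<noteq> []"
    and lm_iterate_dX: "lm ((dX lam ^^ k) s) = (up lam ^^ k) (lm s)"
proof -
  have "(dX lam ^^ k) s \<noteq> 0 \<and> lm ((dX lam ^^ k) s) \<noteq> [] \<and> lm ((dX lam ^^ k) s) = (up lam ^^ k) (lm s)"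
  proof (induction k)
    case (Suc k)
    then have 1: "(dX lam ^^ k) s \<noteq> 0" "lm ((dX lam ^^ k) s) \<noteq> []"
      and 2: "(up lam ^^ k) (lm s) = lm ((dX lam ^^ k) s)"
      by metis+
    show ?case
      unfolding funpow.simps comp_apply lm_dX[OF 1] 2 using dX_nonzero[OF 1] 1 by simp
  qed (use assms in simp)
  then show "(dX lam ^^ k) s \<noteq> 0" "lm ((dX lam ^^ k) s) \<noteq> []"
    "lm ((dX lam ^^ k) s) = (up lam ^^ k) (lm s)"
    by blast+
qed

text \<open>The main term of \<open>d (a d\<^sup>k(s) b)\<close> is, up to a nonzero scalar, of the same form; \<open>shift\<close>
  tells how \<open>(a, k, b)\<close> changes.\<close>

fun shift :: "'k::field \<Rightarrow> (nat \<times> 'x) list \<times> nat \<times> (nat \<times> 'x) list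
    \<Rightarrow> (nat \<times> 'x) list \<times> nat \<times> (nat \<times> 'x) list" where
  "shift lam (a, k, b) =
     (if lam = 0 then if a = [] then ([], Suc k, b) else (up lam a, k, b)
      else (up lam a, Suc k, up lam b))"

text \<open>In weight zero \<open>d(aFb)\<close> is the sum of \<open>d(a)Fb\<close>,
  \<open>a d(F) b\<close> and \<open>aF d(b)\<close>. The main term comes from the summand that
  raises the first letter of the leading word: \<open>d(F) b\<close> if \<open>a\<close> is empty,
  \<open>d(a)Fb\<close> otherwise. The rest is lower.\<close>

lemma dX_generator_0:
  fixes s :: "(nat \<times> 'x::linorder, 'k::field) ncpoly"
  assumes s: "s \<in> S" "s \<noteq> 0" "lm s \<noteq> []" and ab: "a \<in> lists (Delta X)" "b \<in> lists (Delta X)"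
    and sh: "shift (0::'k) (a, k, b) = (a', k', b')"
  shows "dX 0 (mon a * (dX 0 ^^ k) s * mon b) - mon a' * (dX 0 ^^ k') s * mon b'
    \<in> trivial_span 0 X S (up (0::'k) (a @ lm ((dX 0 ^^ k) s) @ b))"
proof -
  define F where "F = (dX 0 ^^ k) s"
  have F: "F \<noteq> 0" "lm F \<noteq> []" and dF: "dX 0 F = (dX 0 ^^ Suc k) s"
    using iterate_dX_nonzero[OF s(2,3)] lm_iterate_dX_nonempty[OF s(2,3)] by (auto simp: F_def)
  let ?T = "trivial_span 0 X S (up (0::'k) (a @ lm F @ b))"
  have free: "d_word 0 u \<in> free_algebra (Delta X)" if "u \<in> lists (Delta X)" for u
    unfolding dX_mon[symmetric] using that by (intro dX_free_algebra free_algebra_mon)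
  note free = free free_algebra_mon
  show ?thesis
  proof (cases "a = []")
    case True
    have "mon [] * F * d_word 0 b \<in> ?T"
      unfolding F_def
      by (rule trivial_span_mult)
        (use s ab free iterate_dX_nonzero[OF s(2,3)] F in
          \<open>auto simp: True up_append_0 simp flip: F_def dest: length_keys_d_word
            intro: append_less_append less_up\<close>)
    moreover have "dX 0 (mon a * F * mon b) - mon a' * (dX 0 ^^ k') s * mon b' = mon [] * F * d_word 0 b"
      using sh by (auto simp: True mon_Nil dX_mult dX_mon dF[symmetric] simp flip: F_def)
    ultimately show ?thesis by (simp flip: F_def)
  next
    case False
    \<comment> \<open>This is \<open>d(a)\<close> without its leading term; the factor one matches
      the shape of \<open>lead_remainder\<close>.\<close>
    define a1 where "a1 = d_word (0::'k) a - smul 1 (mon (up (0::'k) a))"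
    have mons: "mon a \<in> free_algebra (Delta X)" "mon (up (0::'k) a) \<in> free_algebra (Delta X)" "mon b \<in> free_algebra (Delta X)"
      using ab by (auto intro!: free_algebra_mon up_lists)
    have 1: "a1 * F * mon b \<in> ?T"
      unfolding F_def
      by (rule trivial_span_mult)
        (use s ab free iterate_dX_nonzero[OF s(2,3)] F False in
          \<open>auto simp: up_append_0 a1_def simp flip: F_def
            intro!: append_less_append_le free_algebra_diff mons
            dest!: lead_remainder[OF lead_d_word_0[OF False], simplified]\<close>)
    have less: "a @ u < up (0::'k) a @ v" if "length u = length v" for u v
      using that False by (intro append_less_append less_up)
    have 2: "mon a * (dX 0 ^^ Suc k) s * mon b \<in> ?T"
      by (rule trivial_span_mult)
        (use s ab free iterate_dX_nonzero[OF s(2,3), where k = "Suc k"] F mons False in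
          \<open>auto simp: up_append_0 dF[symmetric] lm_dX dX_nonzero simp del: funpow.simps intro!: less\<close>)
    have 3: "mon a * F * d_word 0 b \<in> ?T"
      unfolding F_def
      by (rule trivial_span_mult)
        (use s ab free mons iterate_dX_nonzero[OF s(2,3)] F False in
          \<open>auto simp: up_append_0 simp flip: F_def intro!: less dest: length_keys_d_word\<close>)
    have "a' = up (0::'k) a" "(dX 0 ^^ k') s = F" "b' = b"
      using sh False by (auto simp: F_def)
    then have "dX 0 (mon a * F * mon b) - mon a' * (dX 0 ^^ k') s * mon b'
        = a1 * F * mon b + mon a * (dX 0 ^^ Suc k) s * mon b + mon a * F * d_word 0 b"
      by (simp only: dF[symmetric]) (simp add: dX_mult dX_mon a1_def algebra_simps)
    with 1 2 3 show ?thesis by (auto simp flip: F_def intro: trivial_span_closed)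
  qed
qed

text \<open>Multiplicativity of \<open>E\<close> gives
  \<open>lam d(aFb) = E(a)E(F)E(b) - aFb\<close>, where \<open>E(F) = F + lam d(F)\<close>. So
  \<open>d(aFb)\<close> is \<open>E(a) d(F) E(b)\<close> plus \<open>1/lam\<close> times
  \<open>E(a)FE(b) - aFb\<close>. The leading coefficients of \<open>E(a)\<close> and
  \<open>E(b)\<close> produce the scalar; products with \<open>F\<close> undifferentiated are
  lower.\<close>

lemma dX_generator_nonzero:
  fixes s :: "(nat \<times> 'x::linorder, 'k::field) ncpoly"
  assumes s: "s \<in> S" "s \<noteq> 0" "lm s \<noteq> []" and ab: "a \<in> lists (Delta X)" "b \<in> lists (Delta X)"
    and lam: "lam \<noteq> 0"
  shows "dX lam (mon a * (dX lam ^^ k) s * mon b)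
      - smul (lam ^ (length a + length b)) (mon (up lam a) * (dX lam ^^ Suc k) s * mon (up lam b))
    \<in> trivial_span lam X S (up lam (a @ lm ((dX lam ^^ k) s) @ b))"
proof -
  define F where "F = (dX lam ^^ k) s"
  have F: "F \<noteq> 0" "lm F \<noteq> []" and dF: "dX lam F = (dX lam ^^ Suc k) s"
    using iterate_dX_nonzero[OF s(2,3)] lm_iterate_dX_nonempty[OF s(2,3)] by (auto simp: F_def)
  let ?T = "trivial_span lam X S (up lam (a @ lm F @ b))"
  have up: "up lam (a @ lm F @ b) = up lam a @ up lam (lm F) @ up lam b"
    using lam by (simp add: up_nonzero)
  let ?a = "E lam (mon a)" and ?b = "E lam (mon b)"
  define a1 where "a1 = ?a - smul (lam ^ length a) (mon (up lam a))"
  define b1 where "b1 = ?b - smul (lam ^ length b) (mon (up lam b))"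
  have free: "?a \<in> free_algebra (Delta X)" "?b \<in> free_algebra (Delta X)"
    using ab by (auto intro: free_algebra_E free_algebra_mon)
  have free1: "a1 \<in> free_algebra (Delta X)" "b1 \<in> free_algebra (Delta X)"
    using ab free unfolding a1_def b1_def
    by (auto intro!: free_algebra_diff free_algebra_smul free_algebra_mon up_lists)
  have le: "v \<le> up lam a" if "v \<in> keys ?a" for v
    using lead_E_mon[OF lam, of a] that by (auto simp: lead_def)
  have le': "v \<le> up lam b" if "v \<in> keys ?b" for v
    using lead_E_mon[OF lam, of b] that by (auto simp: lead_def)
  have less: "v < up lam a" if "v \<in> keys a1" for v
    using lead_remainder[OF lead_E_mon[OF lam]] that by (simp add: a1_def)
  have less': "v < up lam b" if "v \<in> keys b1" for v
    using lead_remainder[OF lead_E_mon[OF lam]] that by (simp add: b1_def)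
  have nz: "(dX lam ^^ k) s \<noteq> 0" for k
    using iterate_dX_nonzero[OF s(2,3)] .
  have lm: "lm ((dX lam ^^ Suc k) s) = up lam (lm F)"
    using lm_dX[OF F, of lam] by (simp only: dF)
  \<comment> \<open>The outer words may already be fully raised; strictness comes from
    \<open>lm F\<close>, which is below \<open>up lam (lm F)\<close>.\<close>
  have mono: "u @ lm F @ v < up lam (a @ lm F @ b)" if "u \<le> up lam a" "v \<le> up lam b" for u v
    unfolding up using that F
    by (meson append_le_append append_less_append_le order.strict_trans1 less_up order_refl
        append_less_append_left)
  have 1: "a1 * (dX lam ^^ Suc k) s * ?b \<in> ?T"
    by (rule trivial_span_mult)
      (use s nz free free1 in \<open>auto simp: lm up simp del: funpow.simps
        intro!: append_less_append_le append_le_append less le'\<close>)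
  have 2: "mon (up lam a) * (dX lam ^^ Suc k) s * b1 \<in> ?T"
    by (rule trivial_span_mult)
      (use s nz ab free1 in \<open>auto simp: lm up simp del: funpow.simps
        intro!: append_less_append_left less' free_algebra_mon up_lists\<close>)
  have 3: "?a * F * ?b \<in> ?T"
    unfolding F_def
    by (rule trivial_span_mult)
      (use s nz F free in \<open>auto simp flip: F_def intro!: mono le le'\<close>)
  have le_up: "u \<le> up lam u" for u :: "(nat \<times> 'x) list"
    using less_up[of u lam] by (cases "u = []") auto
  have 4: "mon a * F * mon b \<in> ?T"
    unfolding F_def
    by (rule trivial_span_mult)
      (use s nz F ab in \<open>auto simp flip: F_def intro!: mono le_up free_algebra_mon\<close>)
  have "smul lam (dX lam (mon a * F * mon b)) = ?a * E lam F * ?b - mon a * F * mon b"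
    by (simp flip: E_mult) (simp add: E_def)
  then have "smul (1/lam) (smul lam (dX lam (mon a * F * mon b)))
      = smul (1/lam) (?a * E lam F * ?b - mon a * F * mon b)"
    by simp
  then have "dX lam (mon a * F * mon b) = smul (1/lam) (?a * E lam F * ?b - mon a * F * mon b)"
    using lam by simp
  also have "\<dots> = ?a * dX lam F * ?b + smul (1/lam) (?a * F * ?b - mon a * F * mon b)"
    using lam by (simp add: E_def[of lam F] algebra_simps ncpoly.scale_right_distrib
        ncpoly.scale_right_diff_distrib)
  also have "?a * dX lam F * ?b = a1 * dX lam F * ?b + smul (lam ^ length a) (mon (up lam a) * dX lam F * b1)
     + smul (lam ^ (length a + length b)) (mon (up lam a) * dX lam F * mon (up lam b))"
    by (simp add: a1_def b1_def algebra_simps ncpoly.scale_right_diff_distrib power_add)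
  finally have "dX lam (mon a * F * mon b)
      - smul (lam ^ (length a + length b)) (mon (up lam a) * (dX lam ^^ Suc k) s * mon (up lam b))
      = a1 * (dX lam ^^ Suc k) s * ?b + smul (lam ^ length a) (mon (up lam a) * (dX lam ^^ Suc k) s * b1)
      + smul (1/lam) (?a * F * ?b - mon a * F * mon b)"
    unfolding dF[symmetric] by simp
  then show ?thesis
    using 1 2 3 4 by (auto simp del: funpow.simps simp flip: F_def intro!: trivial_span_closed)
qed


lemma lm_shift:
  fixes s :: "(nat \<times> 'x::linorder, 'k::field) ncpoly"
  assumes s: "s \<noteq> 0" "lm s \<noteq> []" and sh: "shift lam (a, k, b) = (a', k', b')"
  shows "a' @ lm ((dX lam ^^ k') s) @ b' = up lam (a @ lm ((dX lam ^^ k) s) @ b)"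
proof -
  have F: "(dX l ^^ k) s \<noteq> 0" "lm ((dX l ^^ k) s) \<noteq> []" for l
    by (rule iterate_dX_nonzero[OF s] lm_iterate_dX_nonempty[OF s])+
  show ?thesis
    using sh by (cases "lam = 0") (auto simp: up_append_0 up_nonzero lm_dX[OF F] F split: if_splits)
qed

lemma dX_generator:
  fixes s :: "(nat \<times> 'x::linorder, 'k::field) ncpoly"
  assumes "s \<in> S" "s \<noteq> 0" "lm s \<noteq> []" and "a \<in> lists (Delta X)" "b \<in> lists (Delta X)"
    and sh: "shift lam (a, k, b) = (a', k', b')"
  obtains c where "c \<noteq> 0"
    "dX lam (mon a * (dX lam ^^ k) s * mon b) - smul c (mon a' * (dX lam ^^ k') s * mon b')
      \<in> trivial_span lam X S (up lam (a @ lm ((dX lam ^^ k) s) @ b))"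
proof (cases "lam = 0")
  case True
  with dX_generator_0[OF assms(1-5)] sh that[of 1] show thesis by simp
next
  case False
  with dX_generator_nonzero[OF assms(1-5) False, where k = k] sh
    that[of "lam ^ (length a + length b)"]
  show thesis by auto
qed

lemma shift_lists:
  assumes "shift lam (a, k, b) = (a', k', b')" "a \<in> lists (Delta X)" "b \<in> lists (Delta X)"
  shows "a' \<in> lists (Delta X)" "b' \<in> lists (Delta X)"
  using assms up_lists[of a X lam] up_lists[of b X lam]
  by (cases "lam = 0"; cases "a = []"; simp)+

text \<open>The derivative of a generator is a multiple of the shifted generator up to an error that
  is trivial modulo the raised leading word. That word also leads the shifted generator, and
  \<open>up_mono\<close> puts it below \<open>up lam w\<close>.\<close>

lemma dX_trivial_span:
  fixes h :: "(nat \<times> 'x::linorder, 'k::field) ncpoly"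
  assumes S: "\<And>s. s \<in> S \<Longrightarrow> s \<noteq> 0 \<and> lm s \<noteq> []" and h: "h \<in> trivial_span lam X S w"
  shows "dX lam h \<in> trivial_span lam X S (up lam w)"
  using h
proof (induction rule: trivial_span_induct)
  case zero
  then show ?case by (simp add: trivial_span_closed)
next
  case (step c a k s b q)
  obtain a' k' b' where sh: "shift lam (a, k, b) = (a', k', b')" by (metis prod_cases3)
  let ?p = "mon a * (dX lam ^^ k) s * mon b" and ?p' = "mon a' * (dX lam ^^ k') s * mon b'"
  have s: "s \<noteq> 0" "lm s \<noteq> []" using S step(1) by auto
  have less: "up lam (a @ lm ((dX lam ^^ k) s) @ b) < up lam w"
    by (intro up_mono step)
  obtain c' where "c' \<noteq> 0" and c': "dX lam ?p - smul c' ?p' \<in> trivial_span lam X S (up lam (a @ lm ((dX lam ^^ k) s) @ b))"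
    by (rule dX_generator[where X = X, OF step(1) s step(2,3) sh])
  from c' have 1: "dX lam ?p - smul c' ?p' \<in> trivial_span lam X S (up lam w)"
    by (rule subsetD[OF trivial_span_mono[OF less_imp_le[OF less]], rotated])
  have 2: "?p' \<in> trivial_span lam X S (up lam w)"
    using step(1) shift_lists[OF sh step(2,3)] iterate_dX_nonzero[OF s] lm_shift[OF s sh] less
    by (intro trivial_span_base) auto
  have "dX lam (smul c ?p + q) = smul c ((dX lam ?p - smul c' ?p') + smul c' ?p') + dX lam q"
    by (simp add: dX_add dX_smul)
  also have "\<dots> \<in> trivial_span lam X S (up lam w)"
    by (intro trivial_span_closed 1 2 step)
  finally show ?case .
qed

lemma iterate_dX_trivial_span:
  fixes h :: "(nat \<times> 'x::linorder, 'k::field) ncpoly"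
  assumes S: "\<And>s. s \<in> S \<Longrightarrow> s \<noteq> 0 \<and> lm s \<noteq> []" and h: "h \<in> trivial_span lam X S w"
  shows "(dX lam ^^ i) h \<in> trivial_span lam X S ((up lam ^^ i) w)"
  by (induction i) (auto simp: h intro: dX_trivial_span[OF S])

text \<open>Induction on \<open>i\<close>: the error made so far stays trivial by
  \<open>dX_trivial_span\<close>, \<open>dX_generator\<close> adds a new one, and the nonzero
  scalars multiply.\<close>

lemma iterate_dX_generator:
  fixes s :: "(nat \<times> 'x::linorder, 'k::field) ncpoly"
  assumes S: "\<And>s. s \<in> S \<Longrightarrow> s \<noteq> 0 \<and> lm s \<noteq> []" and s: "s \<in> S"
    and ab: "a \<in> lists (Delta X)" "b \<in> lists (Delta X)"
    and sh: "(shift lam ^^ i) (a, k, b) = (a', k', b')"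
  obtains c where "c \<noteq> 0"
    "(dX lam ^^ i) (mon a * (dX lam ^^ k) s * mon b) - smul c (mon a' * (dX lam ^^ k') s * mon b')
      \<in> trivial_span lam X S ((up lam ^^ i) (a @ lm ((dX lam ^^ k) s) @ b))"
    "a' @ lm ((dX lam ^^ k') s) @ b' = (up lam ^^ i) (a @ lm ((dX lam ^^ k) s) @ b)"
    "a' \<in> lists (Delta X)" "b' \<in> lists (Delta X)"
proof -
  have s0: "s \<noteq> 0" "lm s \<noteq> []" using S s by auto
  have "(\<exists>c. c \<noteq> 0 \<and>
      (dX lam ^^ i) (mon a * (dX lam ^^ k) s * mon b) - smul c (mon a' * (dX lam ^^ k') s * mon b')
        \<in> trivial_span lam X S ((up lam ^^ i) (a @ lm ((dX lam ^^ k) s) @ b))) \<and>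
    a' @ lm ((dX lam ^^ k') s) @ b' = (up lam ^^ i) (a @ lm ((dX lam ^^ k) s) @ b) \<and>
    a' \<in> lists (Delta X) \<and> b' \<in> lists (Delta X)"
    using sh
  proof (induction i arbitrary: a' k' b')
    case 0
    then show ?case using ab by (auto intro!: exI[of _ 1] trivial_span_closed(1))
  next
    case (Suc i)
    let ?w = "(up lam ^^ i) (a @ lm ((dX lam ^^ k) s) @ b)"
    let ?p = "(dX lam ^^ i) (mon a * (dX lam ^^ k) s * mon b)"
    obtain a1 k1 b1 where sh1: "(shift lam ^^ i) (a, k, b) = (a1, k1, b1)" by (metis prod_cases3)
    with Suc.prems have sh': "shift lam (a1, k1, b1) = (a', k', b')" by simp
    let ?p1 = "mon a1 * (dX lam ^^ k1) s * mon b1" and ?p' = "mon a' * (dX lam ^^ k') s * mon b'"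
    obtain c where c: "c \<noteq> 0" "?p - smul c ?p1 \<in> trivial_span lam X S ?w"
      and w: "a1 @ lm ((dX lam ^^ k1) s) @ b1 = ?w"
      and ab1: "a1 \<in> lists (Delta X)" "b1 \<in> lists (Delta X)"
      using Suc.IH[OF sh1] by auto
    obtain c' where c': "c' \<noteq> 0" "dX lam ?p1 - smul c' ?p' \<in> trivial_span lam X S (up lam ?w)"
      using dX_generator[OF s s0 ab1 sh'] w by metis
    have "dX lam ?p - smul (c * c') ?p' = dX lam (?p - smul c ?p1) + smul c (dX lam ?p1 - smul c' ?p')"
      by (simp add: dX_diff dX_smul ncpoly.scale_right_diff_distrib)
    also have "\<dots> \<in> trivial_span lam X S (up lam ?w)"
      by (intro trivial_span_closed dX_trivial_span S c c')
    finally show ?case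
      using c c' w lm_shift[OF s0 sh'] shift_lists[OF sh' ab1]
      by (auto intro!: exI[of _ "c * c'"])
  qed
  then show thesis using that by blast
qed


section \<open>Words of leading terms\<close>

text \<open>The leading monomials of the derivatives of polynomials in the letters of order \<open>0\<close>.\<close>

definition lift :: "'k::field \<Rightarrow> nat \<Rightarrow> 'x list \<Rightarrow> (nat \<times> 'x) list" where
  "lift lam i p = (up lam ^^ i) (map (Pair 0) p)"

lemma lift_nonzero: "lam \<noteq> 0 \<Longrightarrow> lift lam i p = map (Pair i) p"
  unfolding lift_def by (induction i) (auto simp: up_nonzero)

lemma lift_0_Cons: "lift (0::'k::field) i (x # p) = (i, x) # map (Pair 0) p"
  unfolding lift_def by (induction i) auto

lemma map_snd_lift [simp]: "map snd (lift lam i p) = p"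
  unfolding lift_def by (induction i) (auto simp: comp_def)

lemma length_lift [simp]: "length (lift lam i p) = length p"
  by (metis length_map map_snd_lift)

lemma lift_eq_Nil [simp]: "lift lam i p = [] \<longleftrightarrow> p = []"
  by (metis length_0_conv length_lift)

lemma lift_lists_iff: "lift lam i p \<in> lists (Delta X) \<longleftrightarrow> p \<in> lists X"
  unfolding lists_Delta_iff by simp

lemma iterate_shift_nonzero:
  "lam \<noteq> 0 \<Longrightarrow> (shift lam ^^ i) (map (Pair 0) a, 0, map (Pair 0) b) = (map (Pair i) a, i, map (Pair i) b)"
  by (induction i) (auto simp: up_nonzero)

lemma iterate_shift_0:
  "(shift (0::'k::field) ^^ i) (map (Pair 0) a, 0, b) =
    (if a = [] then ([], i, b) else (lift (0::'k) i a, 0, b))"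
proof (induction i)
  case (Suc i)
  have "up (0::'k) (lift (0::'k) i a) = lift (0::'k) (Suc i) a"
    by (simp add: lift_def)
  with Suc show ?case by simp
qed (simp add: lift_def)

lemma map_Pair_eq_append:
  assumes "map (Pair i) p = a @ b"
  obtains a0 b0 where "p = a0 @ b0" "a = map (Pair i) a0" "b = map (Pair i) b0"
  using assms unfolding map_eq_append_conv by blast

text \<open>Orders of derivation reveal positions. For \<open>lam \<noteq> 0\<close> all letters of
  \<open>lift lam i p\<close> have order \<open>i\<close>, so the nonempty \<open>q\<close> forces
  \<open>j = i\<close>. For \<open>lam = 0\<close> all letters after the first have order zero: an
  occurrence at the front has \<open>j = i\<close>, a later one \<open>j = 0\<close>. Either way it
  is the \<open>i\<close>-fold shift of an occurrence of \<open>q\<close> in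
  \<open>p\<close>.\<close>

lemma lift_eq_append:
  assumes eq: "lift lam i p = a @ lift lam j q @ b" and q: "q \<noteq> []"
  obtains a0 b0 where "p = a0 @ q @ b0"
    "(shift lam ^^ i) (map (Pair 0) a0, 0, map (Pair 0) b0) = (a, j, b)"
proof (cases "lam = 0")
  case False
  with eq have "map (Pair i) p = a @ map (Pair j) q @ b" by (simp add: lift_nonzero)
  then obtain a0 q0 b0 where 1: "p = a0 @ q0 @ b0" "a = map (Pair i) a0"
      "map (Pair j) q = map (Pair i) q0" "b = map (Pair i) b0"
    by (metis map_Pair_eq_append)
  with q have "j = i" by (cases q; cases q0) auto
  moreover from this 1 have "q = q0" by (auto simp: inj_map_eq_map inj_on_def)
  ultimately show thesis using that 1 False by (simp add: iterate_shift_nonzero)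
next
  case True
  obtain y q' where q': "q = y # q'" using q by (cases q) auto
  have "p \<noteq> []" using eq q length_lift[of lam i p] by auto
  then obtain x p' where p': "p = x # p'" by (cases p) auto
  show thesis
  proof (cases a)
    case Nil
    with eq True have 1: "j = i" "x = y" "map (Pair (0::nat)) p' = map (Pair 0) q' @ b"
      by (auto simp: p' q' lift_0_Cons)
    then obtain q0 b0 where "p' = q0 @ b0" "map (Pair (0::nat)) q' = map (Pair 0) q0" "b = map (Pair 0) b0"
      by (metis map_Pair_eq_append)
    moreover from this have "q' = q0" by (auto simp: inj_map_eq_map inj_on_def)
    ultimately show thesis
      using that[of "[]" b0] 1 Nil True iterate_shift_0[of i "[]" "map (Pair 0) b0"]
      by (simp add: p' q')
  next
    case (Cons c a')
    with eq True have 1: "c = (i, x)" "map (Pair (0::nat)) p' = a' @ (j, y) # map (Pair 0) q' @ b"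
      by (auto simp: p' q' lift_0_Cons)
    \<comment> \<open>The nonempty \<open>a\<close> contains the first letter, so
      \<open>(j, y)\<close> belongs to the tail.\<close>
    then have "j = 0" by (metis in_set_conv_decomp in_set_conv_nth length_map map_eq_append_conv
        list.map_disc_iff fst_conv imageE list.set_map)
    with 1 have "map (Pair (0::nat)) p' = a' @ map (Pair 0) (y # q') @ b" by simp
    then obtain a0 q0 b0 where 2: "p' = a0 @ q0 @ b0" "a' = map (Pair 0) a0"
      "map (Pair (0::nat)) (y # q') = map (Pair 0) q0" "b = map (Pair 0) b0"
      by (metis map_Pair_eq_append)
    from 2(3) have "y # q' = q0" by (auto simp: inj_map_eq_map inj_on_def)
    with 2 1 \<open>j = 0\<close> show thesis
      using that[of "x # a0" b0] Cons True iterate_shift_0[of i "x # a0" "map (Pair 0) b0"]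
      by (auto simp: p' q' lift_0_Cons)
  qed
qed

text \<open>The letters of \<open>u\<close> must have the orders that a lift of a longer word
  prescribes. For \<open>lam \<noteq> 0\<close> the nonempty overlap equates \<open>i\<close> and
  \<open>j\<close>. For \<open>lam = 0\<close>, being shorter than \<open>q\<close>,
  \<open>u\<close> misses the first letter of \<open>lift lam j q\<close>, so its letters have order
  zero.\<close>

lemma lift_overlap:
  assumes eq: "lift lam i p @ u = v @ lift lam j q" and len: "length v < length p" "length u < length q"
  obtains r where "lift lam i p @ u = lift lam i r"
proof (cases "lam = 0")
  case False
  from eq len have "map (Pair i) p @ u = v @ map (Pair j) q" by (simp add: False lift_nonzero)
  then obtain us where us: "(map (Pair i) p = v @ us \<and> us @ u = map (Pair j) q) \<or>
     (map (Pair i) p @ us = v \<and> u = us @ map (Pair j) q)"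
    unfolding append_eq_append_conv2 by blast
  with len have 1: "map (Pair i) p = v @ us" "us @ u = map (Pair j) q" by auto
  with len have "us \<noteq> []" by (metis append_Nil2 length_map less_irrefl)
  obtain p1 p2 where p: "p = p1 @ p2" "us = map (Pair i) p2"
    using 1(1) by (rule map_Pair_eq_append)
  obtain q1 q2 where q: "us = map (Pair j) q1" "u = map (Pair j) q2"
    using 1(2)[symmetric] by (rule map_Pair_eq_append)
  have "i = j" using p q \<open>us \<noteq> []\<close> by (cases p2; cases q1) auto
  then have "lift lam i p @ u = lift lam i (p @ q2)" using False q by (simp add: lift_nonzero)
  then show thesis by (rule that)
next
  case True
  obtain y q' where q': "q = y # q'" using len by (cases q) auto
  obtain x p' where p': "p = x # p'" using len by (cases p) auto
  have "lift lam i p @ u = (v @ [(j, y)]) @ map (Pair 0) q'"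
    using eq True by (simp add: q' lift_0_Cons)
  then obtain us where us: "us @ u = map (Pair 0) q' \<or> u = us @ map (Pair 0) q'"
    unfolding append_eq_append_conv2 by blast
  have "set u \<subseteq> set (map (Pair 0) q')"
    using us
  proof
    assume "us @ u = map (Pair 0) q'"
    then show ?thesis by (metis set_append sup_ge2)
  next
    assume u: "u = us @ map (Pair 0) q'"
    with len q' have "us = []" by simp
    with u show ?thesis by simp
  qed
  then have "u = map (Pair 0) (map snd u)"
    by (induction u) auto
  then have "lift lam i p @ u = lift lam i (p @ map snd u)"
    using True by (simp add: p' lift_0_Cons)
  then show thesis by (rule that)
qed


lemma length_iterate_shift:
  "(shift lam ^^ i) (a, k, b) = (a', k', b') \<Longrightarrow> length a' = length a \<and> length b' = length b"
proof (induction i arbitrary: a' k' b')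
  case (Suc i)
  obtain a1 k1 b1 where "(shift lam ^^ i) (a, k, b) = (a1, k1, b1)" by (metis prod_cases3)
  with Suc show ?case by (force split: if_splits)
qed simp


section \<open>Compositions\<close>

lemma map_Pair_mono: "u < v \<Longrightarrow> map (Pair (n::nat)) u < map (Pair n) (v :: 'x::linorder list)"
proof (induction u arbitrary: v)
  case Nil
  then show ?case by (cases v) auto
next
  case (Cons x u)
  then show ?case by (cases v) (auto simp: Cons_less_Cons)
qed

lemma keys_iX: "keys (iX p) \<subseteq> map (Pair 0) ` keys p"
  using keys_sum[of "\<lambda>u. smul (lookup p u) (mon (map (Pair 0) u))" "keys p"] keys_smul
  unfolding iX_def lin_ext_def by fastforce

lemma lead_iX:
  fixes p :: "('x::linorder, 'k::field) ncpoly"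
  assumes "p \<noteq> 0"
  shows "lead (iX p) (map (Pair 0) (lm p)) (lc p)"
proof -
  have "map (Pair (0::nat)) u \<le> map (Pair 0) (lm p)" if "u \<in> keys p" for u
  proof -
    have "u \<le> lm p" using lead_lm[OF assms] that by (auto simp: lead_def)
    then show ?thesis using map_Pair_mono[of u "lm p" 0] by (auto simp: le_less)
  qed
  then show ?thesis
    using keys_iX[of p] by (auto simp: lead_def lookup_iX lc_def)
qed

lemma
  fixes p :: "('x::linorder, 'k::field) ncpoly"
  assumes "p \<noteq> 0"
  shows iX_nonzero: "iX p \<noteq> 0" and lm_iX: "lm (iX p) = map (Pair 0) (lm p)" and lc_iX: "lc (iX p) = lc p"
  using lead_imp[OF lead_iX[OF assms] lc_nonzero[OF assms]] .

lemma iX_simps: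
  "iX (p + q) = iX p + iX q" "iX (smul c p) = smul c (iX p)" "iX (p * q) = iX p * iX q"
  "iX 1 = 1" "iX 0 = 0" "iX (mon u) = mon (map (Pair 0) u)"
  using alg_hom_on_iX[unfolded alg_hom_on_def] by (auto simp: iX_def)

lemma iX_diff: "iX (p - q) = iX p - iX q"
  by (metis add_diff_cancel_right' diff_add_cancel iX_simps(1))

lemma iX_trivial:
  fixes h :: "('x::linorder, 'k::field) ncpoly"
  assumes S: "\<And>s. s \<in> S \<Longrightarrow> s \<noteq> 0" and h: "trivial_mod X S w h"
  shows "iX h \<in> trivial_span lam X (iX ` S) (map (Pair 0) w)"
  using h unfolding trivial_mod_iff
proof (induction rule: ncpoly.span_induct_alt)
  case base
  then show ?case by (simp add: iX_simps trivial_span_closed(1))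
next
  case (step c p q)
  then obtain a s b where p: "p = mon a * s * mon b" and s: "s \<in> S"
    and ab: "a \<in> lists X" "b \<in> lists X" and less: "a @ lm s @ b < w"
    by auto
  have "iX p = mon (map (Pair 0) a) * (dX lam ^^ 0) (iX s) * mon (map (Pair 0) b)"
    by (simp add: p iX_simps)
  also have "\<dots> \<in> trivial_span lam X (iX ` S) (map (Pair 0) w)"
    using s ab S[OF s] map_Pair_mono[OF less, of 0]
    by (intro trivial_span_base) (auto simp: Delta_def iX_nonzero lm_iX)
  finally show ?case
    using step by (auto simp: iX_simps intro: trivial_span_closed)
qed

lemma lead_nrm: "p \<noteq> 0 \<Longrightarrow> lead (nrm p) (lm p) 1"
  unfolding nrm_def using lead_smul[OF lead_lm, of p "inverse (lc p)"] lc_nonzero[of p] by simp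

lemma free_algebra_iterate_dX:
  "p \<in> free_algebra (Delta X) \<Longrightarrow> (dX lam ^^ k) p \<in> free_algebra (Delta X)"
  by (induction k) (auto intro: dX_free_algebra)

lemma lm_1: "lm (1 :: ('y::linorder, 'k::field) ncpoly) = []"
  by (rule lead_imp(2)[of _ _ 1]) (simp_all add: lead_mon flip: mon_Nil)

text \<open>The leading word of \<open>1\<close> is empty, so every word \<open>v < w\<close> over
  the letters is a generator: take \<open>a = v\<close>, \<open>k = 0\<close> and
  \<open>b = []\<close>.\<close>

lemma lower_in_trivial_span:
  fixes h :: "(nat \<times> 'x::linorder, 'k::field) ncpoly"
  assumes "1 \<in> S" "h \<in> free_algebra (Delta X)" "\<And>v. v \<in> keys h \<Longrightarrow> v < w"
  shows "h \<in> trivial_span lam X S w"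
proof -
  have "h * (dX lam ^^ 0) 1 * 1 \<in> trivial_span lam X S w"
    using assms by (intro trivial_span_mult) (auto simp: free_algebra_1 lm_1 zero_list_def)
  then show ?thesis by simp
qed

lemma lm_in_lists: "p \<in> free_algebra Y \<Longrightarrow> p \<noteq> 0 \<Longrightarrow> lm p \<in> lists Y"
  using Max_in[of "keys p"] unfolding free_algebra_def lm_def by fastforce

lemma monic_eq_1:
  assumes "monic p" "lm p = []"
  shows "p = 1"
proof -
  have p: "lead p [] 1" using lead_lm[of p] assms by (simp add: monic_def)
  then have "keys (p - smul 1 (mon [])) = {}" using lead_remainder[OF p] by fastforce
  then show ?thesis by (simp add: mon_Nil)
qed

text \<open>Outer words on both sides cover both kinds of compositions: \<open>a\<close> and
  \<open>e\<close> are empty for intersections, \<open>a\<close> and \<open>b\<close> for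
  inclusions. Applying \<open>d\<close> \<open>n\<close> times to the trivial composition turns both
  products into multiples of their shifts, up to trivial errors.\<close>

lemma shifted_composition_trivial:
  fixes S :: "('x::linorder, 'k::field) ncpoly set"
  assumes S: "\<forall>s\<in>S. s \<noteq> 0 \<and> lm s \<noteq> []"
    and fg: "f \<in> S" "g \<in> S"
    and w: "w = a @ lm f @ b" "w = c @ lm g @ e" "w \<in> lists X"
    and triv: "trivial_mod X S w (mon a * f * mon b - mon c * g * mon e)"
    and sh: "(shift lam ^^ n) (map (Pair 0) a, 0, map (Pair 0) b) = (a', i, b')"
      "(shift lam ^^ n) (map (Pair 0) c, 0, map (Pair 0) e) = (c', j, e')"
  shows "mon a' * nrm ((dX lam ^^ i) (iX f)) * mon b' - mon c' * nrm ((dX lam ^^ j) (iX g)) * mon e'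
    \<in> trivial_span lam X (iX ` S) (lift lam n w)"
proof -
  let ?T = "trivial_span lam X (iX ` S) (lift lam n w)"
  have iS: "t \<noteq> 0 \<and> lm t \<noteq> []" if "t \<in> iX ` S" for t
    using that S by (auto simp: iX_nonzero lm_iX)
  have f: "f \<noteq> 0" "lm f \<noteq> []" and g: "g \<noteq> 0" "lm g \<noteq> []" using S fg by auto
  have lists: "map (Pair (0::nat)) u \<in> lists (Delta X)" if "u \<in> lists X" for u
    using that by (auto simp: Delta_def)
  have abce: "a \<in> lists X" "b \<in> lists X" "c \<in> lists X" "e \<in> lists X"
    using w by (metis append_in_lists_conv)+
  have wf: "(up lam ^^ n) (map (Pair 0) a @ lm (iX f) @ map (Pair 0) b) = lift lam n w"
    and wg: "(up lam ^^ n) (map (Pair 0) c @ lm (iX g) @ map (Pair 0) e) = lift lam n w"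
    using w(1,2) by (simp_all add: lift_def lm_iX f g flip: map_append)
  define F where "F = (dX lam ^^ i) (iX f)"
  define G where "G = (dX lam ^^ j) (iX g)"
  let ?p = "mon (map (Pair 0) a) * iX f * mon (map (Pair 0) b)"
  let ?q = "mon (map (Pair 0) c) * iX g * mon (map (Pair 0) e)"
  let ?p' = "mon a' * F * mon b'" and ?q' = "mon c' * G * mon e'"
  obtain \<alpha> where \<alpha>: "\<alpha> \<noteq> 0" "(dX lam ^^ n) ?p - smul \<alpha> ?p' \<in> ?T" "a' @ lm F @ b' = lift lam n w"
    using iterate_dX_generator[where S = "iX ` S" and s = "iX f", OF iS imageI[OF fg(1)]
        lists[OF abce(1)] lists[OF abce(2)] sh(1), unfolded funpow_0 wf, folded F_def] by metis
  obtain \<beta> where \<beta>: "\<beta> \<noteq> 0" "(dX lam ^^ n) ?q - smul \<beta> ?q' \<in> ?T" "c' @ lm G @ e' = lift lam n w"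
    using iterate_dX_generator[where S = "iX ` S" and s = "iX g", OF iS imageI[OF fg(2)]
        lists[OF abce(3)] lists[OF abce(4)] sh(2), unfolded funpow_0 wg, folded G_def] by metis
  have diff: "(dX lam ^^ n) (p - q) = (dX lam ^^ n) p - (dX lam ^^ n) q" for p q :: "(nat \<times> 'x, 'k) ncpoly"
    by (induction n) (simp_all add: dX_diff)
  have "(dX lam ^^ n) (iX (mon a * f * mon b - mon c * g * mon e)) \<in> ?T"
    unfolding lift_def by (intro iterate_dX_trivial_span iX_trivial iS triv) (use S in auto)
  then have "(dX lam ^^ n) ?p - (dX lam ^^ n) ?q \<in> ?T"
    by (simp add: iX_diff iX_simps diff)
  from trivial_span_closed(2)[OF trivial_span_closed(3)[OF this \<alpha>(2)] \<beta>(2)]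
  have "((dX lam ^^ n) ?p - (dX lam ^^ n) ?q) - ((dX lam ^^ n) ?p - smul \<alpha> ?p')
      + ((dX lam ^^ n) ?q - smul \<beta> ?q') \<in> ?T"
    .
  then have T: "smul \<alpha> ?p' - smul \<beta> ?q' \<in> ?T" by simp
  have F0: "F \<noteq> 0" and G0: "G \<noteq> 0"
    unfolding F_def G_def using iS fg by (simp_all add: iterate_dX_nonzero)
  have "lead ?p' ((a' @ lm F) @ b') (1 * lc F * 1)" "lead ?q' ((c' @ lm G) @ e') (1 * lc G * 1)"
    by (intro lead_mult lead_mon lead_lm F0 G0)+
  then have "lookup (smul \<alpha> ?p' - smul \<beta> ?q') (lift lam n w) = \<alpha> * lc F - \<beta> * lc G"
    using \<alpha>(3) \<beta>(3) by (simp add: lead_def lookup_minus)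
  \<comment> \<open>The word itself does not occur in a trivial element, so the two scalars agree.\<close>
  moreover have "lift lam n w \<notin> keys (smul \<alpha> ?p' - smul \<beta> ?q')"
    using keys_trivial_span[OF T] by blast
  ultimately have eq: "\<beta> * lc G = \<alpha> * lc F" by (simp add: in_keys_iff)
  \<comment> \<open>Dividing both scaled products by this common value normalises \<open>F\<close>
    and \<open>G\<close> at once.\<close>
  have "mon a' * nrm F * mon b' = smul (1 / (\<alpha> * lc F)) (smul \<alpha> ?p')"
    using \<alpha>(1) lc_nonzero[OF F0] by (simp add: nrm_def inverse_eq_divide)
  moreover have "mon c' * nrm G * mon e' = smul (1 / (\<alpha> * lc F)) (smul \<beta> ?q')"
    unfolding eq[symmetric] using \<beta>(1) lc_nonzero[OF G0]
    by (simp add: nrm_def inverse_eq_divide)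
  ultimately have "mon a' * nrm F * mon b' - mon c' * nrm G * mon e'
      = smul (1 / (\<alpha> * lc F)) (smul \<alpha> ?p' - smul \<beta> ?q')"
    by (simp only: ncpoly.scale_right_diff_distrib)
  also have "\<dots> \<in> ?T"
    by (rule trivial_span_closed(4)[OF T])
  finally show ?thesis
    unfolding F_def G_def .
qed

lemma lm_iterate_dX_iX:
  fixes f :: "('x::linorder, 'k::field) ncpoly"
  assumes "f \<noteq> 0" "lm f \<noteq> []"
  shows "lm ((dX lam ^^ i) (iX f)) = lift lam i (lm f)"
  using lm_iterate_dX[of "iX f" i lam] assms by (simp add: iX_nonzero lm_iX lift_def)

lemma iterate_dX_1: "(dX lam ^^ i) 1 = (if i = 0 then 1 else 0)"
  by (induction i) auto

text \<open>Constants need their own case, since the formula for leading words of derivatives fails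
  for them. Otherwise both occurrences in \<open>w\<close> are read back as shifts of occurrences in
  an unlifted word, where the composition is trivial by assumption.\<close>

theorem diff_GS_basis_iX:
  fixes S :: "('x::linorder, 'k::field) ncpoly set"
  assumes GS: "GS_basis X S"
  shows "diff_GS_basis lam X (iX ` S)"
proof -
  have S: "S \<subseteq> free_algebra X" and monic: "\<And>s. s \<in> S \<Longrightarrow> monic s"
    using GS by (auto simp: GS_basis_def)
  have nz: "s \<noteq> 0" if "s \<in> S" for s using monic[OF that] by (simp add: monic_def)
  have inter: "trivial_mod X S (lm f @ u) (f * mon u - mon v * g)"
    if "f \<in> S" "g \<in> S" "u \<in> lists X" "v \<in> lists X" "lm f @ u = v @ lm g"
      "length u < length (lm g)" for f g u v
    using GS that unfolding GS_basis_def by (metis length_append nat_add_left_cancel_less)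
  have incl: "trivial_mod X S (lm f) (f - mon u * g * mon v)"
    if "f \<in> S" "g \<in> S" "u \<in> lists X" "v \<in> lists X" "lm f = u @ lm g @ v" for f g u v
    using GS that unfolding GS_basis_def by blast
  have lists_lm: "lm s \<in> lists X" if "s \<in> S" for s
    by (rule lm_in_lists[OF subsetD[OF S that] nz[OF that]])
  have free: "iX s \<in> free_algebra (Delta X)" if "s \<in> S" for s
    using S that by (blast intro: iX_free_algebra)
  have "(w = lm F @ u \<and> w = v @ lm G \<and> length w < length (lm (iX f)) + length (lm (iX g))
           \<longrightarrow> nrm F * mon u - mon v * nrm G \<in> trivial_span lam X (iX ` S) w) \<and>
        (w = lm F \<and> w = u @ lm G @ v
           \<longrightarrow> nrm F - mon u * nrm G * mon v \<in> trivial_span lam X (iX ` S) w)"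
    if fg: "f \<in> S" "g \<in> S" and uv: "u \<in> lists (Delta X)" "v \<in> lists (Delta X)"
      and F: "F = (dX lam ^^ i) (iX f)" "F \<noteq> 0" and G: "G = (dX lam ^^ j) (iX g)" "G \<noteq> 0"
    for f g i j u v w F G
  proof (cases "\<exists>s\<in>S. lm s = []")
    case True
    \<comment> \<open>Then \<open>1 \<in> S\<close>, so every polynomial below \<open>w\<close> is trivial.\<close>
    then have 1: "1 \<in> iX ` S"
      using monic monic_eq_1 iX_simps(4) by (metis imageI)
    have lower: "P - Q \<in> trivial_span lam X (iX ` S) w"
      if "P \<in> free_algebra (Delta X)" "Q \<in> free_algebra (Delta X)" "lead P w 1" "lead Q w 1" for P Q
    proof (rule lower_in_trivial_span[OF 1])
      show "P - Q \<in> free_algebra (Delta X)" by (intro free_algebra_diff that)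
      fix v assume "v \<in> keys (P - Q)"
      moreover from this have "v \<noteq> w" using that by (auto simp: in_keys_iff lookup_minus lead_def)
      ultimately show "v < w"
        using keys_minus_subset[of P Q] that by (force simp: lead_def)
    qed
    have FG: "nrm F \<in> free_algebra (Delta X)" "nrm G \<in> free_algebra (Delta X)"
      unfolding nrm_def F G using fg
      by (auto intro: free_algebra_smul free_algebra_iterate_dX free)
    have mons: "mon u \<in> free_algebra (Delta X)" "mon v \<in> free_algebra (Delta X)"
      using uv by (auto intro: free_algebra_mon)
    show ?thesis
    proof (intro conjI impI; elim conjE)
      assume w: "w = lm F @ u" "w = v @ lm G"
      have "lead (nrm F * mon u) (lm F @ u) (1 * 1)" "lead (mon v * nrm G) (v @ lm G) (1 * 1)"
        by (intro lead_mult lead_mon lead_nrm F G)+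
      then show "nrm F * mon u - mon v * nrm G \<in> trivial_span lam X (iX ` S) w"
        using w by (intro lower free_algebra_mult FG mons) auto
    next
      assume w: "w = lm F" "w = u @ lm G @ v"
      have "lead (mon u * nrm G * mon v) ((u @ lm G) @ v) (1 * 1 * 1)"
        by (intro lead_mult lead_mon lead_nrm G)
      then show "nrm F - mon u * nrm G * mon v \<in> trivial_span lam X (iX ` S) w"
        using w lead_nrm[OF F(2)] by (intro lower free_algebra_mult FG mons) auto
    qed
  next
    case False
    then have S': "\<forall>s\<in>S. s \<noteq> 0 \<and> lm s \<noteq> []" using nz by auto
    then have f: "f \<noteq> 0" "lm f \<noteq> []" and g: "g \<noteq> 0" "lm g \<noteq> []" using fg by auto
    have lm: "lm F = lift lam i (lm f)" "lm G = lift lam j (lm g)"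
      "lm (iX f) = map (Pair 0) (lm f)" "lm (iX g) = map (Pair 0) (lm g)"
      using f g by (simp_all add: F G lm_iterate_dX_iX lm_iX)
    note comp = shifted_composition_trivial[OF S' fg, where lam = lam and n = i]
    show ?thesis
    proof (intro conjI impI; elim conjE)
      assume w: "w = lm F @ u" "w = v @ lm G"
        and "length w < length (lm (iX f)) + length (lm (iX g))"
      then have len: "length v < length (lm f)" "length u < length (lm g)"
        and eq: "lift lam i (lm f) @ u = v @ lift lam j (lm g)"
        using lm by (metis add_less_cancel_right length_append length_lift length_map,
            metis add_less_cancel_left length_append length_lift length_map, metis)
      \<comment> \<open>This is the word of the underlying composition of \<open>f\<close> and
        \<open>g\<close>; its \<open>i\<close>-fold lift is \<open>w\<close>.\<close>
      obtain r where r: "lift lam i (lm f) @ u = lift lam i r"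
        using lift_overlap[OF eq len] .
      obtain a b where 1: "r = a @ lm f @ b"
        "(shift lam ^^ i) (map (Pair 0) a, 0, map (Pair 0) b) = ([], i, u)"
        using lift_eq_append[of lam i r "[]" i "lm f" u] f r by auto
      obtain c e where 2: "r = c @ lm g @ e"
        "(shift lam ^^ i) (map (Pair 0) c, 0, map (Pair 0) e) = (v, j, [])"
        using lift_eq_append[of lam i r v j "lm g" "[]"] g r eq by auto
      \<comment> \<open>Lengths survive the shift, so the underlying overlap is as proper as the
        lifted one.\<close>
      have a: "a = []" and b: "length b = length u" and e: "e = []"
        using length_iterate_shift[OF 1(2)] length_iterate_shift[OF 2(2)] by auto
      have "lift lam i r \<in> lists (Delta X)"
        using uv lists_lm[OF fg(1)] by (metis append_in_lists_conv lift_lists_iff r)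
      then have rX: "r \<in> lists X" by (simp only: lift_lists_iff)
      then have bc: "b \<in> lists X" "c \<in> lists X"
        using 1(1) 2(1) by (metis append_in_lists_conv)+
      have "trivial_mod X S (lm f @ b) (f * mon b - mon c * g)"
        using bc 1 2 a b e len by (intro inter fg) auto
      then have "trivial_mod X S r (mon a * f * mon b - mon c * g * mon e)"
        using 1(1) a e by (simp add: mon_Nil)
      from comp[OF 1(1) 2(1) rX this 1(2) 2(2)]
      show "nrm F * mon u - mon v * nrm G \<in> trivial_span lam X (iX ` S) w"
        using w lm r by (simp add: mon_Nil F G)
    next
      assume w: "w = lm F" "w = u @ lm G @ v"
      \<comment> \<open>The occurrence of \<open>lm f\<close> in itself supplies the shift of empty
        outer words that \<open>comp\<close> asks for.\<close>
      obtain a b where 1: "lm f = a @ lm f @ b"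
        "(shift lam ^^ i) (map (Pair 0) a, 0, map (Pair 0) b) = ([], i, [])"
        using lift_eq_append[of lam i "lm f" "[]" i "lm f" "[]"] f by auto
      have a: "a = []" "b = []" using length_iterate_shift[OF 1(2)] by auto
      obtain c e where 2: "lm f = c @ lm g @ e"
        "(shift lam ^^ i) (map (Pair 0) c, 0, map (Pair 0) e) = (u, j, v)"
        using lift_eq_append[of lam i "lm f" u j "lm g" v] g w lm by auto
      have "trivial_mod X S (lm f) (f - mon c * g * mon e)"
        using 2 lists_lm[OF fg(1)] by (intro incl fg) auto
      then have "trivial_mod X S (lm f) (mon a * f * mon b - mon c * g * mon e)"
        using a by (simp add: mon_Nil)
      from comp[OF 1(1) 2(1) lists_lm[OF fg(1)] this 1(2) 2(2)]
      show "nrm F - mon u * nrm G * mon v \<in> trivial_span lam X (iX ` S) w"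
        using w lm by (simp add: mon_Nil F G)
    qed
  qed
  moreover have "iX ` S \<subseteq> free_algebra (Delta X)" using free by blast
  moreover have "\<forall>s\<in>iX ` S. monic s"
    using monic by (auto simp: monic_def iX_nonzero lc_iX)
  ultimately show ?thesis
    unfolding diff_GS_basis_def diff_trivial_mod_iff Let_def by (auto simp del: funpow.simps)
qed

text \<open>By \<open>lift_eq_append\<close> an inclusion between leading words of derivatives is
  the shift of one between leading words in \<open>S\<close>, where only the vacuous one
  exists.\<close>

theorem diff_GS_minimal_iX:
  fixes S :: "('x::linorder, 'k::field) ncpoly set"
  assumes GS: "GS_basis X S" and min: "GS_minimal X S"
  shows "diff_GS_minimal lam X (iX ` S)"
proof -
  have S: "S \<subseteq> free_algebra X" and monic: "\<And>s. s \<in> S \<Longrightarrow> monic s"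
    using GS by (auto simp: GS_basis_def)
  have nz: "s \<noteq> 0" if "s \<in> S" for s using monic[OF that] by (simp add: monic_def)
  have lists_lm: "lm s \<in> lists X" if "s \<in> S" for s
    by (rule lm_in_lists[OF subsetD[OF S that] nz[OF that]])
  have min': "f = g \<and> u = [] \<and> v = []"
    if "f \<in> S" "g \<in> S" "lm f = u @ lm g @ v" for f g u v
    using min that lists_lm[OF that(1)] unfolding GS_minimal_def
    by (metis append_in_lists_conv)
  have "iX f = iX g \<and> i = j \<and> a = [] \<and> b = []"
    if fg: "f \<in> S" "g \<in> S" and nF: "(dX lam ^^ i) (iX f) \<noteq> 0" and nG: "(dX lam ^^ j) (iX g) \<noteq> 0"
      and eq: "lm ((dX lam ^^ i) (iX f)) = a @ lm ((dX lam ^^ j) (iX g)) @ b"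
    for f g i j a b
  proof (cases "\<exists>s\<in>S. lm s = []")
    case True
    then have "1 \<in> S" "lm (1 :: ('x, 'k) ncpoly) = []"
      using monic monic_eq_1 by metis+
    \<comment> \<open>The empty word divides every leading word, so minimality makes
      \<open>1\<close> the only element of \<open>S\<close>; its proper derivatives vanish.\<close>
    then have "f = 1" "g = 1" using min'[OF _ \<open>1 \<in> S\<close>, of _ "[]"] fg by auto
    then show ?thesis
      using nF nG eq by (auto simp: lm_1 iX_simps iterate_dX_1 split: if_splits)
  next
    case False
    then have f: "f \<noteq> 0" "lm f \<noteq> []" and g: "g \<noteq> 0" "lm g \<noteq> []" using nz fg by auto
    have eq': "lift lam i (lm f) = a @ lift lam j (lm g) @ b"
      using eq f g by (simp add: lm_iterate_dX_iX)
    then obtain c e where 1: "lm f = c @ lm g @ e"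
      "(shift lam ^^ i) (map (Pair 0) c, 0, map (Pair 0) e) = (a, j, b)"
      using g by (metis lift_eq_append)
    then have "f = g" and ce: "c = []" "e = []" using min'[OF fg] by auto
    \<comment> \<open>On empty outer words \<open>shift\<close> merely counts derivations;
      comparison with \<open>(a, j, b)\<close> gives \<open>i = j\<close>.\<close>
    moreover have "(shift lam ^^ i) ([], 0, []) = ([], i, [] :: (nat \<times> 'x) list)"
      by (induction i) auto
    ultimately show ?thesis using 1(2) by simp
  qed
  then show ?thesis
    unfolding diff_GS_minimal_def by blast
qed

text \<open>The monomials of \<open>iX f\<close> have letters of order zero only and cannot contain
  the leading word of a proper derivative. What remains is an occurrence of \<open>lm g\<close> in a
  monomial of \<open>f\<close>, which reducedness of \<open>S\<close> excludes.\<close>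

theorem diff_GS_reduced_iX:
  fixes S :: "('x::linorder, 'k::field) ncpoly set"
  assumes GS: "GS_basis X S" and red: "GS_reduced X S"
  shows "diff_GS_reduced lam X (iX ` S)"
  unfolding diff_GS_reduced_def
proof (intro ballI notI; elim bexE exE conjE)
  fix f' t g' j a b
  assume f': "f' \<in> iX ` S" and t: "t \<in> keys f'" and g': "g' \<in> iX ` S - {(dX lam ^^ i) f' | i. True}"
    and nz: "(dX lam ^^ j) g' \<noteq> 0" and eq: "t = a @ lm ((dX lam ^^ j) g') @ b"
  obtain f g where f: "f \<in> S" "f' = iX f" and g: "g \<in> S" "g' = iX g" using f' g' by auto
  \<comment> \<open>The excluded derivatives include the zeroth one, which is \<open>f'\<close>
    itself.\<close>
  have "g' \<noteq> (dX lam ^^ 0) f'" using g' by blast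
  then have ne: "g \<noteq> f" using f g by auto
  have monic: "monic g" and fX: "f \<in> free_algebra X" using GS f g by (auto simp: GS_basis_def)
  then have g0: "g \<noteq> 0" by (simp add: monic_def)
  obtain p where p: "p \<in> keys f" "t = map (Pair 0) p" using t keys_iX[of f] f by auto
  have "j = 0"
  proof (cases "lm g = []")
    case True
    then have "g = 1" by (rule monic_eq_1[OF monic])
    then show ?thesis using nz g by (auto simp: iX_simps iterate_dX_1 split: if_splits)
  next
    case False
    then have "lift lam 0 p = a @ lift lam j (lm g) @ b"
      using eq g g0 p by (simp add: lm_iterate_dX_iX lift_def)
    \<comment> \<open>For \<open>i = 0\<close> the iterated shift is the identity, so its middle
      component \<open>j\<close> is zero.\<close>
    with False show ?thesis by (metis lift_eq_append funpow_0 prod.inject)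
  qed
  then have "map (Pair (0::nat)) p = a @ map (Pair 0) (lm g) @ b"
    using eq g g0 p by (simp add: lm_iX)
  then have "p = map snd a @ lm g @ map snd b"
    by (metis (no_types) lift_def funpow_0 map_append map_snd_lift)
  moreover have "p \<in> lists X" using fX p by (auto simp: free_algebra_def)
  ultimately show False
    using red f g ne p unfolding GS_reduced_def by (metis DiffI append_in_lists_conv singletonD)
qed

theorem theorem3p1:
  fixes lam :: "'k::field_char_0"
    and X :: "'x::wellorder set"
    and I_A S :: "('x, 'k) ncpoly set"
    and scaleA :: "'k \<Rightarrow> 'a::{ring,monoid_mult} \<Rightarrow> 'a"
    and \<pi> :: "('x, 'k) ncpoly \<Rightarrow> 'a"
    and scaleD :: "'k \<Rightarrow> 'd::{ring,monoid_mult} \<Rightarrow> 'd"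
    and dD :: "'d \<Rightarrow> 'd"
    and iA :: "'a \<Rightarrow> 'd"
    and \<rho> :: "(nat \<times> 'x, 'k) ncpoly \<Rightarrow> 'd"
  assumes "assoc_algebra scaleA"
    and "ideal_in (free_algebra X) I_A"
    and "alg_hom_on (free_algebra X) smul scaleA \<pi>"
    and "\<pi> ` free_algebra X = UNIV"
    and "{p \<in> free_algebra X. \<pi> p = 0} = I_A"
    and "GS_basis_of X S I_A"
    and "free_differential_algebra TYPE('r::{ring,monoid_mult}) lam scaleA scaleD dD iA"
    and "diff_hom_on (free_algebra (Delta X)) smul (dX lam) scaleD dD \<rho>"
    and "\<rho> ` free_algebra (Delta X) = UNIV"
    and "{p \<in> free_algebra (Delta X). \<rho> p = 0} = DI lam X (iX ` S)"
    and "\<forall>p \<in> free_algebra X. \<rho> (iX p) = iA (\<pi> p)"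
  shows "diff_GS_basis_of lam X (iX ` S) (DI lam X (iX ` S))
    \<and> (GS_minimal X S \<longrightarrow> diff_GS_minimal lam X (iX ` S))
    \<and> (GS_reduced X S \<longrightarrow> diff_GS_reduced lam X (iX ` S))"
proof -
  have "GS_basis X S" using assms(6) by (simp add: GS_basis_of_def)
  then show ?thesis
    by (simp add: diff_GS_basis_of_def diff_GS_basis_iX diff_GS_minimal_iX diff_GS_reduced_iX)
qed

end
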